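(* Let $X_1,\ldots,X_n\in\mathbb{C}^{d\times d}$ be a sequence of independent self-adjoint random matrices such that $\mathbb{E}X_i=0$ for $i=1,\ldots,n$, and let $\sigma\ge 0$ be a real number with $\sigma^2\geq\left\|\sum_{i=1}^n\mathbb{E}X_i^2\right\|$. Assume that $\|X_i\|\leq U$ almost surely for all $1\leq i\leq n$ and some positive $U\in\mathbb{R}$. Then, for any $t\geq\frac{1}{6}\left(U+\sqrt{U^2+36\sigma^2}\right)$, $$\mathbb{P}\left(\left\|\sum_{i=1}^n X_i\right\|>t\right)\leq 14\, r\left(\sum_{i=1}^n\mathbb{E}X_i^2\right)\exp\left[-\frac{t^2/2}{\sigma^2+tU/3}\right].$$
   Context: $\|\cdot\|$ denotes the operator norm (largest singular value); the expectation of a random matrix is taken entrywise. For a nonnegative definite matrix $A\in\mathbb{C}^{d\times d}$, the effective rank is $r(A):=\dfrac{\operatorname{tr}(A)}{\|A\|}$ (with $r(0):=0$). *)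

theory Defs
  imports "HOL-Probability.Probability"
begin

definition conj_transpose :: "complex^'n^'m \<Rightarrow> complex^'m^'n" where
  "conj_transpose A = (\<chi> i j. cnj (A $ j $ i))"

definition self_adjoint :: "complex^'d^'d \<Rightarrow> bool" where
  "self_adjoint A \<longleftrightarrow> conj_transpose A = A"

(* The library norm on complex^'d is the Euclidean one, so this is the spectral norm.
   The library norm on complex^'d^'d is the Frobenius norm and is not the one meant here. *)
definition op_norm :: "complex^'d^'d \<Rightarrow> real" where
  "op_norm A = onorm ((*v) A)"

definition mat_expectation :: "'w measure \<Rightarrow> ('w \<Rightarrow> complex^'d^'d) \<Rightarrow> complex^'d^'d" where
  "mat_expectation M X = (\<chi> i j. integral\<^sup>L M (\<lambda>\<omega>. X \<omega> $ i $ j))"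

(* Meant for nonnegative definite A, whose trace is a nonnegative real;
   Re only converts it to type real. *)
definition effective_rank :: "complex^'d^'d \<Rightarrow> real" where
  "effective_rank A = (if A = 0 then 0 else Re (trace A) / op_norm A)"

end

(*
  The bound follows from the Laplace transform method applied to 2 cosh x - 2 instead of exp:
  subtracting the value at 0 replaces the dimension by the effective rank, because
  tr (exp (c V) - 1) <= r(V) (exp (c |V|) - 1) by convexity.  The even function treats S and -S
  at once and has no linear term.

  The Laplace transform is controlled by the one-step inequality
  E tr exp (H + X) <= tr exp (H + V) whenever E exp X <= exp V, a form of Lieb's theorem.  It comes
  from the joint convexity of the relative entropy D(A, B) = tr A (log A - log B), through
    a (log a - log b) = integral over s > 0 of a / (1 + s) - a b / (a + s b),
  where a b / (a + s b) is the minimum over m of s a m^2 + b (1 - s m)^2, so that the operator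
  version is a minimum of linear functions of (A, B).  Its tangent functional at (E T, exp V),
  evaluated at T = exp (H + X) and exp X and averaged, gives tr (E T) (log (E T) - V) <= tr (H E T);
  Klein's inequality turns this into tr (E T) <= tr exp (H + V).

  Self-adjoint complex matrices are treated as symmetric operators on the real Euclidean space
  underlying C^d, so real traces are twice the complex ones.
*)

theory Submission
  imports Defs
begin

section \<open>Orthonormal bases and the spectral theorem\<close>

text \<open>The obstacle is noncommutativity: \<open>H\<close>, \<open>X\<close> and
  \<open>V\<close> share no eigenbasis. Every operator is therefore given by an eigenbasis and its
  eigenvalues, a function of it changes only the eigenvalues, and a trace of two operators becomes a
  double sum with weights (u . v)^2, which add up to 1 over either basis. Operator logarithms thus
  appear only as \<open>ln\<close> of eigenvalues, and each operator inequality reduces to one for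
  real numbers. Convexity enters through a supporting linear functional, which commutes with the
  expectation.

  The integral over s is cut at \<open>R\<close>, so that integrands are continuous on a compact
  interval. The truncation error paid at every outcome is linear in A and can be averaged; the
  quadratic one is paid only at the base point. Then \<open>R\<close> grows.

  The hypothesis on t means t^2 >= \<sigma>^2 + t U / 3, that is r t >= 1 for the Bernstein choice r
  = t / (\<sigma>^2 + t U / 3). This keeps 2 cosh (r t) - 2 comparable with exp (r t), and the
  comparison produces 14. For \<sigma> = 0 this choice has r U = 3, where the moment bound breaks
  down, so another r is taken.\<close>

definition orthonormal_basis :: "'a::euclidean_space set \<Rightarrow> bool" where
  "orthonormal_basis U \<longleftrightarrow> finite U \<and> (\<forall>u\<in>U. \<forall>v\<in>U. u \<bullet> v = (if u = v then 1 else 0))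
     \<and> (\<forall>x. (\<Sum>u\<in>U. (x \<bullet> u) *\<^sub>R u) = x)"

text \<open>Eigenbasis and eigenvalues are carried as data, so that a function of an operator is
  expressed by keeping \<open>U\<close> and changing \<open>a\<close>. Linearity makes the values on
  \<open>U\<close> determine \<open>f\<close>.\<close>

definition diagonal_in :: "('a::euclidean_space \<Rightarrow> 'a) \<Rightarrow> 'a set \<Rightarrow> ('a \<Rightarrow> real) \<Rightarrow> bool" where
  "diagonal_in f U a \<longleftrightarrow> orthonormal_basis U \<and> linear f \<and> (\<forall>u\<in>U. f u = a u *\<^sub>R u)"

lemma orthonormal_basis_finite: "orthonormal_basis U \<Longrightarrow> finite U"
  unfolding orthonormal_basis_def by blast

lemma orthonormal_basis_Basis: "orthonormal_basis (Basis :: 'a::euclidean_space set)"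
  unfolding orthonormal_basis_def by (simp only: inner_Basis euclidean_representation) (simp add: inner_Basis)

lemma orthonormal_basis_expand:
  assumes "orthonormal_basis U"
  shows "(\<Sum>u\<in>U. (x \<bullet> u) *\<^sub>R u) = x"
  using assms by (simp add: orthonormal_basis_def)

lemma orthonormal_basis_inner:
  assumes "orthonormal_basis U"
  shows "x \<bullet> y = (\<Sum>u\<in>U. (u \<bullet> x) * (u \<bullet> y))"
proof -
  have "x \<bullet> y = (\<Sum>u\<in>U. (x \<bullet> u) *\<^sub>R u) \<bullet> y"
    by (simp only: orthonormal_basis_expand[OF assms])
  also have "\<dots> = (\<Sum>u\<in>U. (u \<bullet> x) * (u \<bullet> y))"
    unfolding inner_sum_left inner_scaleR_left by (simp add: inner_commute)
  finally show ?thesis .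
qed

lemma orthonormal_basis_norm:
  assumes "orthonormal_basis U"
  shows "(norm x)\<^sup>2 = (\<Sum>u\<in>U. (u \<bullet> x)\<^sup>2)"
  using orthonormal_basis_inner[OF assms, of x x]
  unfolding power2_norm_eq_inner by (simp add: power2_eq_square)

lemma diagonal_in_inner:
  assumes "diagonal_in f U a"
  shows "x \<bullet> f y = (\<Sum>u\<in>U. a u * (u \<bullet> x) * (u \<bullet> y))"
proof -
  have U: "orthonormal_basis U" and f: "linear f" and e: "\<And>u. u \<in> U \<Longrightarrow> f u = a u *\<^sub>R u"
    using assms by (auto simp: diagonal_in_def)
  have "f y = f (\<Sum>u\<in>U. (y \<bullet> u) *\<^sub>R u)"
    by (simp only: orthonormal_basis_expand[OF U])
  also have "\<dots> = (\<Sum>u\<in>U. (y \<bullet> u) *\<^sub>R a u *\<^sub>R u)"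
    by (simp add: linear_sum[OF f] linear_scale[OF f] e)
  finally have fy: "f y = (\<Sum>u\<in>U. (y \<bullet> u) *\<^sub>R a u *\<^sub>R u)" .
  show ?thesis unfolding fy
    by (simp add: inner_sum_right inner_commute mult_ac)
qed

lemma diagonal_in_eigen:
  assumes "diagonal_in f U a" "u \<in> U"
  shows "f u = a u *\<^sub>R u" "norm u = 1" "u \<bullet> u = 1"
proof -
  have e: "\<forall>u\<in>U. f u = a u *\<^sub>R u" and o: "\<forall>u\<in>U. \<forall>v\<in>U. u \<bullet> v = (if u = v then 1 else 0)"
    using assms(1) unfolding diagonal_in_def orthonormal_basis_def by blast+
  show "f u = a u *\<^sub>R u" using e assms(2) by blast
  show "u \<bullet> u = 1" using o assms(2) by simp
  thus "norm u = 1" by (simp add: norm_eq_1)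
qed

lemma nonneg_quadratic_linear_coeff:
  fixes c d :: real
  assumes "\<And>e. 0 \<le> e * c + e\<^sup>2 * d"
  shows "c = 0"
proof (rule ccontr)
  assume c: "c \<noteq> 0"
  \<comment> \<open>With d at most k - 1, the test point e = -c / k makes the quadratic at most -(c
    / k)^2, which is negative.\<close>
  define k where "k = 1 + \<bar>d\<bar>"
  have k: "k > 0" "d \<le> k - 1" by (auto simp: k_def)
  have "0 \<le> - c / k * c + (- c / k)\<^sup>2 * d" by (rule assms)
  also have "\<dots> \<le> - c / k * c + (- c / k)\<^sup>2 * (k - 1)"
    using k by (intro add_left_mono mult_left_mono) auto
  also have "\<dots> = - (c\<^sup>2 / k\<^sup>2)"
    using k by (simp add: field_simps power2_eq_square)
  also have "\<dots> < 0"
    using c k by simp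
  finally show False by simp
qed

text \<open>A maximiser of the Rayleigh quotient on the compact unit sphere of \<open>S\<close> is
  an eigenvector.\<close>

lemma symmetric_eigenvector:
  fixes f :: "'a::euclidean_space \<Rightarrow> 'a"
  assumes f: "linear f" and sym: "\<And>x y. f x \<bullet> y = x \<bullet> f y"
    and S: "subspace S" "f ` S \<subseteq> S" "S \<noteq> {0}"
  obtains x m where "x \<in> S" "norm x = 1" "f x = m *\<^sub>R x"
proof -
  let ?K = "S \<inter> sphere 0 1"
  have cont: "continuous_on T f" for T
    using f by (simp add: linear_continuous_on linear_conv_bounded_linear)
  have "compact ?K"
    by (intro closed_Int_compact closed_subspace S compact_sphere)
  moreover obtain z where "z \<in> S" "z \<noteq> 0"
    using S subspace_0 by blast
  hence "(1 / norm z) *\<^sub>R z \<in> ?K"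
    using S by (auto simp: subspace_scale)
  hence "?K \<noteq> {}" by blast
  moreover have "continuous_on ?K (\<lambda>x. x \<bullet> f x)"
    by (intro continuous_intros cont)
  ultimately have "\<exists>x\<in>?K. \<forall>y\<in>?K. y \<bullet> f y \<le> x \<bullet> f x"
    by (rule continuous_attains_sup)
  then obtain x where x: "x \<in> ?K" and max: "\<And>y. y \<in> ?K \<Longrightarrow> y \<bullet> f y \<le> x \<bullet> f x"
    by blast
  define m where "m = x \<bullet> f x"
  have nx: "x \<bullet> x = 1" using x by (simp add: norm_eq_1)
  have le: "y \<bullet> f y \<le> m * (y \<bullet> y)" if "y \<in> S" for y
  proof (cases "y = 0")
    case True
    then show ?thesis by simp
  next
    case False
    have "(1 / norm y) *\<^sub>R y \<in> ?K"
      using S that False by (auto simp: subspace_scale)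
    from max[OF this] have "(y \<bullet> f y) / (norm y)\<^sup>2 \<le> m"
      by (simp add: m_def linear_scale[OF f] power2_eq_square)
    thus ?thesis using False
      by (simp add: divide_le_eq power2_norm_eq_inner)
  qed
  \<comment> \<open>The residual of the eigenvector equation lies in \<open>S\<close> by invariance,
    so x + e w is an admissible competitor. The form m |y|^2 - y . f y is nonnegative on
    \<open>S\<close> and vanishes at x, and its linear coefficient along w is 2 (w . w), which must
    be 0.\<close>
  define w where "w = m *\<^sub>R x - f x"
  have wS: "w \<in> S" unfolding w_def using x S by (auto intro!: subspace_diff subspace_scale)
  have "2 * (w \<bullet> w) = 0"
  proof (rule nonneg_quadratic_linear_coeff)
    fix e :: real
    have "x + e *\<^sub>R w \<in> S"
      using x wS S by (intro subspace_add subspace_scale) auto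
    from le[OF this]
    have i: "(x + e *\<^sub>R w) \<bullet> (f x + e *\<^sub>R f w) \<le> m * ((x + e *\<^sub>R w) \<bullet> (x + e *\<^sub>R w))"
      by (simp only: linear_add[OF f] linear_scale[OF f])
    have eq: "m * ((x + e *\<^sub>R w) \<bullet> (x + e *\<^sub>R w)) - (x + e *\<^sub>R w) \<bullet> (f x + e *\<^sub>R f w)
        = m * (x \<bullet> x) - x \<bullet> f x + e * (2 * (m * (x \<bullet> w) - f x \<bullet> w)) + e\<^sup>2 * (m * (w \<bullet> w) - w \<bullet> f w)"
      unfolding inner_add_left inner_add_right inner_scaleR_left inner_scaleR_right
            sym[of x w, symmetric] inner_commute[of w x] inner_commute[of w "f x"] power2_eq_square
      by (simp only: ring_distribs mult_ac)
    have ww: "w \<bullet> w = m * (x \<bullet> w) - f x \<bullet> w"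
      by (subst (1) w_def) (simp only: inner_diff_left inner_scaleR_left)
    have z: "m * (x \<bullet> x) - x \<bullet> f x = 0" by (simp add: nx m_def)
    show "0 \<le> e * (2 * (w \<bullet> w)) + e\<^sup>2 * (m * (w \<bullet> w) - w \<bullet> f w)"
      using i eq z unfolding ww[symmetric] by linarith
  qed
  hence "w = 0" by simp
  hence "f x = m *\<^sub>R x" by (simp add: w_def)
  with x show ?thesis using that by auto
qed

text \<open>By symmetry the orthogonal complement of an eigenvector inside \<open>S\<close> is again
  invariant, and its dimension is smaller. The statement speaks of invariant subspaces so that the
  induction applies to that complement.\<close>

lemma symmetric_eigenbasis_subspace:
  fixes f :: "'a::euclidean_space \<Rightarrow> 'a"
  assumes f: "linear f" and sym: "\<And>x y. f x \<bullet> y = x \<bullet> f y"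
    and "subspace S" "f ` S \<subseteq> S"
  shows "\<exists>U a. finite U \<and> U \<subseteq> S \<and> (\<forall>u\<in>U. \<forall>v\<in>U. u \<bullet> v = (if u = v then 1 else 0))
     \<and> (\<forall>u\<in>U. f u = a u *\<^sub>R u) \<and> (\<forall>x\<in>S. (\<Sum>u\<in>U. (x \<bullet> u) *\<^sub>R u) = x)"
  using assms(3,4)
proof (induction "dim S" arbitrary: S rule: less_induct)
  case less
  show ?case
  proof (cases "S = {0}")
    case True
    show ?thesis by (rule exI[of _ "{}"], rule exI[of _ "\<lambda>_. 0"]) (simp add: True)
  next
    case False
    obtain e m where e: "e \<in> S" "norm e = 1" "f e = m *\<^sub>R e"
      by (rule symmetric_eigenvector[OF f sym less.prems False])
    define S' where "S' = {x\<in>S. e \<bullet> x = 0}"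
    have ee: "e \<bullet> e = 1" using e by (simp add: norm_eq_1)
    have sub: "subspace S'"
      using less.prems(1) by (auto simp: S'_def subspace_def inner_add_right)
    have "e \<bullet> f x = 0" if "e \<bullet> x = 0" for x
      using that sym[of e x] e(3) by simp
    hence inv: "f ` S' \<subseteq> S'"
      using less.prems(2) unfolding S'_def by blast
    have "e \<in> S" "e \<notin> S'" using e ee by (auto simp: S'_def)
    hence "S' \<subset> S" unfolding S'_def by blast
    hence "dim S' < dim S"
      using sub less.prems(1) by (intro dim_psubset) (simp add: span_eq_iff[THEN iffD2])
    from less.hyps[OF this sub inv] obtain U a where U: "finite U" "U \<subseteq> S'"
        "\<forall>u\<in>U. \<forall>v\<in>U. u \<bullet> v = (if u = v then 1 else 0)"
        "\<forall>u\<in>U. f u = a u *\<^sub>R u" "\<forall>x\<in>S'. (\<Sum>u\<in>U. (x \<bullet> u) *\<^sub>R u) = x"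
      by blast
    have orth: "u \<bullet> e = 0" "e \<bullet> u = 0" if "u \<in> U" for u
      using that U(2) by (auto simp: S'_def inner_commute)
    hence eU: "e \<notin> U" using ee by auto
    have rep: "(\<Sum>u\<in>insert e U. (x \<bullet> u) *\<^sub>R u) = x" if "x \<in> S" for x
    proof -
      let ?y = "x - (x \<bullet> e) *\<^sub>R e"
      have "?y \<in> S'"
        using that e less.prems(1) by (simp add: S'_def subspace_diff subspace_scale inner_diff_right ee inner_commute)
      hence "?y = (\<Sum>u\<in>U. (?y \<bullet> u) *\<^sub>R u)" using U(5) by simp
      also have "\<dots> = (\<Sum>u\<in>U. (x \<bullet> u) *\<^sub>R u)"
        by (intro sum.cong) (auto simp: inner_diff_left orth)
      finally have "x = (x \<bullet> e) *\<^sub>R e + (\<Sum>u\<in>U. (x \<bullet> u) *\<^sub>R u)"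
        by (simp only: diff_eq_eq add.commute)
      thus ?thesis using sum.insert[OF U(1) eU, of "\<lambda>u. (x \<bullet> u) *\<^sub>R u"] by (rule_tac trans) auto
    qed
    show ?thesis
    proof (intro exI conjI)
      show "insert e U \<subseteq> S" using e U(2) by (auto simp: S'_def)
      show "\<forall>u\<in>insert e U. f u = (a(e := m)) u *\<^sub>R u" using U(4) e(3) by auto
      show "\<forall>x\<in>S. (\<Sum>u\<in>insert e U. (x \<bullet> u) *\<^sub>R u) = x" using rep by blast
      show "\<forall>u\<in>insert e U. \<forall>v\<in>insert e U. u \<bullet> v = (if u = v then 1 else 0)"
        using U(3) eU orth ee by auto
    qed (use U(1) in simp)
  qed
qed

theorem spectral_theorem:
  fixes f :: "'a::euclidean_space \<Rightarrow> 'a"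
  assumes "linear f" and "\<And>x y. f x \<bullet> y = x \<bullet> f y"
  obtains U a where "diagonal_in f U a"
proof -
  obtain U a where U: "finite U" "\<forall>u\<in>U. \<forall>v\<in>U. u \<bullet> v = (if u = v then 1 else 0)"
     "\<forall>u\<in>U. f u = a u *\<^sub>R u" "\<forall>x\<in>UNIV. (\<Sum>u\<in>U. (x \<bullet> u) *\<^sub>R u) = x"
    using symmetric_eigenbasis_subspace[OF assms subspace_UNIV subset_UNIV] by (elim exE conjE)
  have "diagonal_in f U a"
    unfolding diagonal_in_def orthonormal_basis_def using U assms(1) by simp
  thus ?thesis by (rule that)
qed

section \<open>Trace\<close>

definition real_trace :: "('a::euclidean_space \<Rightarrow> 'a) \<Rightarrow> real" where
  "real_trace f = (\<Sum>b\<in>Basis. b \<bullet> f b)"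

lemma real_trace_basis:
  assumes "linear f" "orthonormal_basis U"
  shows "real_trace f = (\<Sum>u\<in>U. u \<bullet> f u)"
proof -
  have "real_trace f = (\<Sum>b\<in>Basis. \<Sum>u\<in>U. (u \<bullet> b) * (u \<bullet> f b))"
    unfolding real_trace_def by (simp flip: orthonormal_basis_inner[OF assms(2)])
  also have "\<dots> = (\<Sum>u\<in>U. \<Sum>b\<in>Basis. (u \<bullet> b) * (u \<bullet> f b))"
    by (rule sum.swap)
  also have "\<dots> = (\<Sum>u\<in>U. u \<bullet> f u)"
  proof (rule sum.cong[OF refl])
    fix u
    have "f u = f (\<Sum>b\<in>Basis. (u \<bullet> b) *\<^sub>R b)" by (simp add: euclidean_representation)
    also have "\<dots> = (\<Sum>b\<in>Basis. (u \<bullet> b) *\<^sub>R f b)"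
      by (simp add: linear_sum[OF assms(1)] linear_scale[OF assms(1)])
    finally show "(\<Sum>b\<in>Basis. (u \<bullet> b) * (u \<bullet> f b)) = u \<bullet> f u" by (simp add: inner_sum_right)
  qed
  finally show ?thesis .
qed

lemma real_trace_diagonal:
  assumes "diagonal_in f U a"
  shows "real_trace f = (\<Sum>u\<in>U. a u)"
  using assms diagonal_in_eigen[OF assms]
  by (subst real_trace_basis[of f U]) (auto simp: diagonal_in_def)

text \<open>Both sides are tr (K* A K). Moving K to the other side turns the sum over the standard
  basis into |K' u|^2, which Parseval evaluates in any orthonormal basis. This lets a map built from
  one pair of eigenbases be tested against operators diagonal in others.\<close>

lemma sum_inner_adjoint:
  assumes A: "diagonal_in A U a" and V: "orthonormal_basis V"
    and K: "\<And>x y. K x \<bullet> y = x \<bullet> K' y"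
  shows "(\<Sum>b\<in>Basis. K b \<bullet> A (K b)) = (\<Sum>u\<in>U. \<Sum>v\<in>V. a u * (v \<bullet> K' u)\<^sup>2)"
proof -
  have "(\<Sum>b\<in>Basis. K b \<bullet> A (K b)) = (\<Sum>b\<in>Basis. \<Sum>u\<in>U. a u * (u \<bullet> K b)\<^sup>2)"
    by (simp add: diagonal_in_inner[OF A] power2_eq_square mult_ac)
  also have "\<dots> = (\<Sum>u\<in>U. \<Sum>b\<in>Basis. a u * (u \<bullet> K b)\<^sup>2)"
    by (rule sum.swap)
  also have "\<dots> = (\<Sum>u\<in>U. \<Sum>v\<in>V. a u * (v \<bullet> K' u)\<^sup>2)"
  proof (rule sum.cong[OF refl])
    fix u
    have "u \<bullet> K b = b \<bullet> K' u" for b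
      by (metis K inner_commute)
    thus "(\<Sum>b\<in>Basis. a u * (u \<bullet> K b)\<^sup>2) = (\<Sum>v\<in>V. a u * (v \<bullet> K' u)\<^sup>2)"
      using orthonormal_basis_norm[OF V, of "K' u"] orthonormal_basis_norm[OF orthonormal_basis_Basis, of "K' u"]
      by (simp flip: sum_distrib_left)
  qed
  finally show ?thesis .
qed

section \<open>Joint convexity of the relative entropy\<close>

definition positive_diagonal_in :: "('a::euclidean_space \<Rightarrow> 'a) \<Rightarrow> 'a set \<Rightarrow> ('a \<Rightarrow> real) \<Rightarrow> bool" where
  "positive_diagonal_in f U a \<longleftrightarrow> diagonal_in f U a \<and> (\<forall>u\<in>U. 0 < a u)"

text \<open>The operator minimising \<open>s tr (G\<^sup>* A G) + tr ((1 - s G) B (1 - s G)\<^sup>*)\<close> over \<open>G\<close>, where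
  \<open>A\<close>, \<open>B\<close> have eigenbases \<open>U\<close>, \<open>V\<close> with eigenvalues \<open>a\<close>, \<open>b\<close>.\<close>

definition psum_map ::
  "'a::euclidean_space set \<Rightarrow> ('a \<Rightarrow> real) \<Rightarrow> 'a set \<Rightarrow> ('a \<Rightarrow> real) \<Rightarrow> real \<Rightarrow> 'a \<Rightarrow> 'a" where
  "psum_map U a V b s x = (\<Sum>u\<in>U. (\<Sum>v\<in>V. b v / (a u + s * b v) * (u \<bullet> v) * (v \<bullet> x)) *\<^sub>R u)"

definition psum_map_adj ::
  "'a::euclidean_space set \<Rightarrow> ('a \<Rightarrow> real) \<Rightarrow> 'a set \<Rightarrow> ('a \<Rightarrow> real) \<Rightarrow> real \<Rightarrow> 'a \<Rightarrow> 'a" where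
  "psum_map_adj U a V b s x = (\<Sum>v\<in>V. (\<Sum>u\<in>U. b v / (a u + s * b v) * (u \<bullet> v) * (u \<bullet> x)) *\<^sub>R v)"

definition entropy_integrand1 where
  "entropy_integrand1 U a V b f s =
     real_trace f / (1 + s) - s * (\<Sum>e\<in>Basis. psum_map U a V b s e \<bullet> f (psum_map U a V b s e))"

definition entropy_integrand2 where
  "entropy_integrand2 U a V b f s =
     (\<Sum>e\<in>Basis. (e - s *\<^sub>R psum_map_adj U a V b s e) \<bullet> f (e - s *\<^sub>R psum_map_adj U a V b s e))"

definition entropy_tangent1 where
  "entropy_tangent1 U a V b R f = integral {0..R} (entropy_integrand1 U a V b f)"

definition entropy_tangent2 where
  "entropy_tangent2 U a V b R f = integral {0..R} (entropy_integrand2 U a V b f)"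

lemma psum_map_adjoint: "psum_map U a V b s x \<bullet> y = x \<bullet> psum_map_adj U a V b s y"
proof -
  have "psum_map U a V b s x \<bullet> y = (\<Sum>u\<in>U. \<Sum>v\<in>V. b v / (a u + s * b v) * (u \<bullet> v) * (v \<bullet> x) * (u \<bullet> y))"
    by (simp add: psum_map_def inner_sum_left sum_distrib_right)
  also have "\<dots> = (\<Sum>v\<in>V. \<Sum>u\<in>U. b v / (a u + s * b v) * (u \<bullet> v) * (v \<bullet> x) * (u \<bullet> y))"
    by (rule sum.swap)
  also have "\<dots> = x \<bullet> psum_map_adj U a V b s y"
    by (simp add: psum_map_adj_def inner_sum_right sum_distrib_left mult_ac inner_commute)
  finally show ?thesis .
qed

text \<open>In its own bases the map has the scalar minimisers of \<open>parallel_sum_eq\<close> as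
  entries, with w = u . v. This is the source of tangency at the base point.\<close>

lemma psum_map_inner_basis:
  assumes "orthonormal_basis U" "orthonormal_basis V" "u \<in> U" "v \<in> V"
  shows "u \<bullet> psum_map U a V b s v = b v / (a u + s * b v) * (u \<bullet> v)"
proof -
  have fin: "finite U" "finite V" using assms orthonormal_basis_finite by auto
  have U: "x \<bullet> y = (if x = y then 1 else 0)" if "x \<in> U" "y \<in> U" for x y
    using assms(1) that by (auto simp: orthonormal_basis_def)
  have V: "x \<bullet> y = (if x = y then 1 else 0)" if "x \<in> V" "y \<in> V" for x y
    using assms(2) that by (auto simp: orthonormal_basis_def)
  have "u \<bullet> psum_map U a V b s v = (\<Sum>u'\<in>U. \<Sum>v'\<in>V. b v' / (a u' + s * b v') * (u' \<bullet> v') * (v' \<bullet> v) * (u \<bullet> u'))"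
    by (simp add: psum_map_def inner_sum_right sum_distrib_right)
  also have "\<dots> = (\<Sum>u'\<in>U. \<Sum>v'\<in>V. if u' = u \<and> v' = v then b v / (a u + s * b v) * (u \<bullet> v) else 0)"
    using assms(3,4) by (intro sum.cong refl) (auto simp: U V)
  also have "\<dots> = (\<Sum>u'\<in>U. if u' = u then b v / (a u + s * b v) * (u \<bullet> v) else 0)"
    using fin assms(4) by (intro sum.cong refl) (auto simp: sum.delta)
  also have "\<dots> = b v / (a u + s * b v) * (u \<bullet> v)"
    using fin assms(3) by (simp add: sum.delta)
  finally show ?thesis .
qed

text \<open>The operator objective decouples into one scalar problem for each pair of eigenvectors,
  with m = u . G v. The primed bases belong to the operators being tested and the unprimed ones to
  \<open>G\<close>, so \<open>parallel_sum_le\<close> applies pair by pair for every base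
  point.\<close>

lemma psum_quadratic_form:
  fixes A :: "'a::euclidean_space \<Rightarrow> 'a" and U V :: "'a set" and a b :: "'a \<Rightarrow> real" and s :: real
  assumes A: "diagonal_in A U' a'" and B: "diagonal_in B V' b'"
  defines "G \<equiv> psum_map U a V b s" and "G' \<equiv> psum_map_adj U a V b s"
  shows "s * (\<Sum>e\<in>Basis. G e \<bullet> A (G e)) + (\<Sum>e\<in>Basis. (e - s *\<^sub>R G' e) \<bullet> B (e - s *\<^sub>R G' e))
    = (\<Sum>u\<in>U'. \<Sum>v\<in>V'. s * a' u * (u \<bullet> G v)\<^sup>2 + b' v * (u \<bullet> v - s * (u \<bullet> G v))\<^sup>2)"
proof -
  have ob: "orthonormal_basis U'" "orthonormal_basis V'"
    using A B by (auto simp: diagonal_in_def)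
  have adj: "G x \<bullet> y = x \<bullet> G' y" for x y
    by (simp add: G_def G'_def psum_map_adjoint)
  have "(\<Sum>e\<in>Basis. G e \<bullet> A (G e)) = (\<Sum>u\<in>U'. \<Sum>v\<in>V'. a' u * (v \<bullet> G' u)\<^sup>2)"
    by (rule sum_inner_adjoint[OF A ob(2) adj])
  moreover have "v \<bullet> G' u = u \<bullet> G v" for u v
    using adj[of v u] by (simp add: inner_commute)
  moreover have "(\<Sum>e\<in>Basis. (e - s *\<^sub>R G' e) \<bullet> B (e - s *\<^sub>R G' e))
     = (\<Sum>v\<in>V'. \<Sum>u\<in>U'. b' v * (u \<bullet> (v - s *\<^sub>R G v))\<^sup>2)"
  proof (rule sum_inner_adjoint[OF B ob(1)])
    fix x y
    have "G' x \<bullet> y = x \<bullet> G y" using adj[of y x] by (simp add: inner_commute)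
    thus "(x - s *\<^sub>R G' x) \<bullet> y = x \<bullet> (y - s *\<^sub>R G y)"
      by (simp add: inner_diff_left inner_diff_right)
  qed
  ultimately show ?thesis
    by (subst (asm) sum.swap) (simp add: sum.distrib sum_distrib_left inner_diff_right mult_ac)
qed

section \<open>Scalar parallel sums and the truncated integral for the logarithm\<close>

lemma parallel_sum_le:
  fixes a b s m w :: real
  assumes "0 < a" "0 < b" "0 \<le> s"
  shows "w\<^sup>2 * (a * b / (a + s * b)) \<le> s * a * m\<^sup>2 + b * (w - s * m)\<^sup>2"
proof -
  have p: "a + s * b > 0" using assms by (simp add: add_pos_nonneg)
  \<comment> \<open>Completing the square in m; it vanishes at m = b w / (a + s b), the value used
    in \<open>parallel_sum_eq\<close>.\<close>
  have "s * a * m\<^sup>2 + b * (w - s * m)\<^sup>2 - w\<^sup>2 * (a * b / (a + s * b))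
      = s * ((a + s * b) * m - b * w)\<^sup>2 / (a + s * b)"
    using p by (simp add: divide_simps) algebra
  also have "\<dots> \<ge> 0" using p assms by simp
  finally show ?thesis by simp
qed

lemma parallel_sum_eq:
  fixes a b s w :: real
  assumes "0 < a" "0 < b" "0 \<le> s"
  defines "m \<equiv> b / (a + s * b) * w"
  shows "s * a * m\<^sup>2 + b * (w - s * m)\<^sup>2 = w\<^sup>2 * (a * b / (a + s * b))"
proof -
  have p: "a + s * b > 0" using assms by (simp add: add_pos_nonneg)
  have w: "w - s * m = a * w / (a + s * b)" using p by (simp add: m_def divide_simps) algebra
  show ?thesis unfolding w unfolding m_def using p
    by (simp add: divide_simps) algebra
qed

text \<open>Over all s > 0 each term alone diverges logarithmically; the compensator a / (1 + s)
  cancels the divergence, and the value tends to a (ln a - ln b) as \<open>R\<close> grows.\<close>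

lemma has_integral_log_difference:
  fixes a b R :: real
  assumes "0 < a" "0 < b" "0 \<le> R"
  shows "((\<lambda>s. a / (1 + s) - a * b / (a + s * b)) has_integral
           a * (ln (1 + R) - ln (a + R * b) + ln a)) {0..R}"
proof -
  have "((\<lambda>s. a / (1 + s) - a * b / (a + s * b)) has_integral
      (a * (ln (1 + R) - ln (a + R * b)) - a * (ln (1 + 0) - ln (a + 0 * b)))) {0..R}"
  proof (rule fundamental_theorem_of_calculus[OF assms(3)])
    fix s assume "s \<in> {0..R}"
    hence "1 + s > 0" "a + s * b > 0" using assms by (auto simp: add_pos_nonneg)
    thus "((\<lambda>s. a * (ln (1 + s) - ln (a + s * b))) has_vector_derivative
        a / (1 + s) - a * b / (a + s * b)) (at s within {0..R})"
      unfolding has_real_derivative_iff_has_vector_derivative[symmetric]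
      by (auto intro!: derivative_eq_intros simp: field_simps)
  qed
  thus ?thesis by (simp add: algebra_simps)
qed

text \<open>The truncation error is a ln y for y = (1 + R) b / (a + R b), which tends to 1. The
  inequality ln z <= z - 1 at z = y and at z = 1 / y gives the two sides. The upper error a / R is
  linear in a, so in the double sum it becomes a trace.\<close>

lemma log_difference_bounds:
  fixes a b R :: real
  assumes "0 < a" "0 < b" "0 < R"
  shows "a * (ln (1 + R) - ln (a + R * b) + ln a) \<le> a * (ln a - ln b) + a / R"
    and "a * (ln a - ln b) - (a\<^sup>2 / b) / R \<le> a * (ln (1 + R) - ln (a + R * b) + ln a)"
proof -
  have p: "a + R * b > 0" "1 + R > 0" "a + R * b \<ge> R * b" using assms by (auto simp: add_pos_nonneg)
  define y where "y = (1 + R) * b / (a + R * b)"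
  have y: "y > 0" using p assms by (simp add: y_def)
  have ly: "ln y = ln (1 + R) + ln b - ln (a + R * b)"
    using p assms by (simp add: y_def ln_mult ln_div)
  have "y - 1 = (b - a) / (a + R * b)" using p by (simp add: y_def field_simps)
  also have "\<dots> \<le> b / (a + R * b)" using p assms by (intro divide_right_mono) auto
  also have "\<dots> \<le> b / (R * b)" using p assms by (intro divide_left_mono) auto
  also have "\<dots> = 1 / R" using assms by simp
  finally have "ln y \<le> 1 / R" using ln_le_minus_one[OF y] by linarith
  hence "a * ln y \<le> a * (1 / R)" using assms by (intro mult_left_mono) auto
  thus "a * (ln (1 + R) - ln (a + R * b) + ln a) \<le> a * (ln a - ln b) + a / R"
    by (simp add: ly algebra_simps)
  have "1 / y - 1 = (a + R * b) / ((1 + R) * b) - ((1 + R) * b) / ((1 + R) * b)"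
    using p assms by (simp add: y_def)
  also have "\<dots> = (a - b) / ((1 + R) * b)"
    unfolding diff_divide_distrib[symmetric] by (simp add: algebra_simps)
  also have "\<dots> \<le> a / ((1 + R) * b)" using p assms by (intro divide_right_mono) auto
  also have "\<dots> \<le> a / (R * b)" using p assms by (intro divide_left_mono mult_right_mono) auto
  finally have "1 / y - 1 \<le> a / (R * b)" .
  moreover have "- ln y \<le> 1 / y - 1" using ln_le_minus_one[of "1 / y"] y by (simp add: ln_div)
  ultimately have "a * (- ln y) \<le> a * (a / (R * b))" using assms by (intro mult_left_mono) auto
  thus "a * (ln a - ln b) - (a\<^sup>2 / b) / R \<le> a * (ln (1 + R) - ln (a + R * b) + ln a)"
    using assms by (simp add: ly algebra_simps power2_eq_square)
qed

section \<open>The tangent functional: integrability, linearity, monotonicity\<close>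

lemma continuous_on_psum_map:
  assumes "positive_diagonal_in A U a" "positive_diagonal_in B V b"
  shows "continuous_on {0..R} (\<lambda>s. psum_map U a V b s x)"
    and "continuous_on {0..R} (\<lambda>s. psum_map_adj U a V b s x)"
proof -
  have "a u + s * b v \<noteq> 0" if "u \<in> U" "v \<in> V" "s \<in> {0..R}" for u v s
    using assms that unfolding positive_diagonal_in_def
    by (metis add_pos_nonneg atLeastAtMost_iff less_eq_real_def mult_nonneg_nonneg order_less_irrefl)
  thus "continuous_on {0..R} (\<lambda>s. psum_map U a V b s x)"
    "continuous_on {0..R} (\<lambda>s. psum_map_adj U a V b s x)"
    unfolding psum_map_def psum_map_adj_def
    by (auto intro!: continuous_intros)
qed

lemma integrable_entropy_integrand:
  assumes "positive_diagonal_in A U a" "positive_diagonal_in B V b" "linear f"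
  shows "entropy_integrand1 U a V b f integrable_on {0..R}"
    and "entropy_integrand2 U a V b f integrable_on {0..R}"
proof -
  have f: "continuous_on S (\<lambda>s. f (g s))" if "continuous_on S g" for S and g :: "real \<Rightarrow> _"
    using that assms(3) by (simp add: bounded_linear.continuous_on linear_conv_bounded_linear)
  have "continuous_on {0..R} (entropy_integrand1 U a V b f)"
    unfolding entropy_integrand1_def
    by (intro continuous_intros f continuous_on_psum_map[OF assms(1,2)]) auto
  thus "entropy_integrand1 U a V b f integrable_on {0..R}"
    by (rule integrable_continuous_real)
  have "continuous_on {0..R} (entropy_integrand2 U a V b f)"
    unfolding entropy_integrand2_def
    by (intro continuous_intros f continuous_on_psum_map[OF assms(1,2)])
  thus "entropy_integrand2 U a V b f integrable_on {0..R}"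
    by (rule integrable_continuous_real)
qed

lemma entropy_tangent_add:
  assumes "positive_diagonal_in A U a" "positive_diagonal_in B V b" "linear f" "linear g"
  shows "entropy_tangent1 U a V b R (\<lambda>x. f x + g x) = entropy_tangent1 U a V b R f + entropy_tangent1 U a V b R g"
    and "entropy_tangent2 U a V b R (\<lambda>x. f x + g x) = entropy_tangent2 U a V b R f + entropy_tangent2 U a V b R g"
proof -
  have "entropy_integrand1 U a V b (\<lambda>x. f x + g x) = (\<lambda>s. entropy_integrand1 U a V b f s + entropy_integrand1 U a V b g s)"
    by (simp add: entropy_integrand1_def fun_eq_iff real_trace_def inner_add_right sum.distrib algebra_simps add_divide_distrib)
  thus "entropy_tangent1 U a V b R (\<lambda>x. f x + g x) = entropy_tangent1 U a V b R f + entropy_tangent1 U a V b R g"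
    using integrable_entropy_integrand[OF assms(1,2)] assms(3,4)
    by (simp add: entropy_tangent1_def integral_add)
  have "entropy_integrand2 U a V b (\<lambda>x. f x + g x) = (\<lambda>s. entropy_integrand2 U a V b f s + entropy_integrand2 U a V b g s)"
    by (simp add: entropy_integrand2_def fun_eq_iff inner_add_right sum.distrib)
  thus "entropy_tangent2 U a V b R (\<lambda>x. f x + g x) = entropy_tangent2 U a V b R f + entropy_tangent2 U a V b R g"
    using integrable_entropy_integrand[OF assms(1,2)] assms(3,4)
    by (simp add: entropy_tangent2_def integral_add)
qed

lemma entropy_tangent_scale:
  "entropy_tangent1 U a V b R (\<lambda>x. c *\<^sub>R f x) = c * entropy_tangent1 U a V b R f"
  "entropy_tangent2 U a V b R (\<lambda>x. c *\<^sub>R f x) = c * entropy_tangent2 U a V b R f"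
proof -
  have "entropy_integrand1 U a V b (\<lambda>x. c *\<^sub>R f x) = (\<lambda>s. c * entropy_integrand1 U a V b f s)"
    by (simp add: entropy_integrand1_def fun_eq_iff real_trace_def algebra_simps flip: sum_distrib_left)
  thus "entropy_tangent1 U a V b R (\<lambda>x. c *\<^sub>R f x) = c * entropy_tangent1 U a V b R f"
    by (simp add: entropy_tangent1_def)
  have "entropy_integrand2 U a V b (\<lambda>x. c *\<^sub>R f x) = (\<lambda>s. c * entropy_integrand2 U a V b f s)"
    by (simp add: entropy_integrand2_def fun_eq_iff flip: sum_distrib_left)
  thus "entropy_tangent2 U a V b R (\<lambda>x. c *\<^sub>R f x) = c * entropy_tangent2 U a V b R f"
    by (simp add: entropy_tangent2_def)
qed

text \<open>The integrand is a sum of values of the quadratic form of \<open>f\<close>, hence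
  monotone in the operator order. As this part enters with a minus sign, E exp X may replace the
  larger exp V.\<close>

lemma entropy_tangent2_mono:
  assumes "positive_diagonal_in A U a" "positive_diagonal_in B V b" "linear f" "linear g"
    and "\<And>x. x \<bullet> f x \<le> x \<bullet> g x"
  shows "entropy_tangent2 U a V b R f \<le> entropy_tangent2 U a V b R g"
  unfolding entropy_tangent2_def
  by (intro integral_le integrable_entropy_integrand[OF assms(1,2)] assms(3,4))
     (simp add: entropy_integrand2_def assms(5) sum_mono)

lemma trace_double_sum:
  assumes "diagonal_in A U a" "orthonormal_basis V"
  shows "real_trace A = (\<Sum>u\<in>U. \<Sum>v\<in>V. (u \<bullet> v)\<^sup>2 * a u)"
proof -
  have "(\<Sum>v\<in>V. (u \<bullet> v)\<^sup>2) = 1" if "u \<in> U" for u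
    using orthonormal_basis_norm[OF assms(2), of u] diagonal_in_eigen[OF assms(1) that]
    by (simp add: inner_commute)
  thus ?thesis by (simp add: real_trace_diagonal[OF assms(1)] flip: sum_distrib_right)
qed

lemma entropy_integrand_sum:
  assumes "diagonal_in A U' a'" "diagonal_in B V' b'"
  shows "entropy_integrand1 U a V b A s - entropy_integrand2 U a V b B s =
     (\<Sum>u\<in>U'. \<Sum>v\<in>V'. (u \<bullet> v)\<^sup>2 * (a' u / (1 + s)) - (s * a' u * (u \<bullet> psum_map U a V b s v)\<^sup>2
         + b' v * (u \<bullet> v - s * (u \<bullet> psum_map U a V b s v))\<^sup>2))"
proof -
  have "orthonormal_basis V'" using assms(2) by (simp add: diagonal_in_def)
  from trace_double_sum[OF assms(1) this]
  have "real_trace A / (1 + s) = (\<Sum>u\<in>U'. \<Sum>v\<in>V'. (u \<bullet> v)\<^sup>2 * (a' u / (1 + s)))"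
    by (simp add: sum_divide_distrib)
  thus ?thesis
    using psum_quadratic_form[OF assms, of s U a V b]
    by (simp add: entropy_integrand1_def entropy_integrand2_def sum_subtractf)
qed

lemma has_integral_relative_entropy:
  assumes "positive_diagonal_in A U a" "positive_diagonal_in B V b" "0 \<le> R"
  shows "((\<lambda>s. \<Sum>u\<in>U. \<Sum>v\<in>V. (u \<bullet> v)\<^sup>2 * (a u / (1 + s) - a u * b v / (a u + s * b v))) has_integral
     (\<Sum>u\<in>U. \<Sum>v\<in>V. (u \<bullet> v)\<^sup>2 * (a u * (ln (1 + R) - ln (a u + R * b v) + ln (a u))))) {0..R}"
  using assms unfolding positive_diagonal_in_def diagonal_in_def
  by (intro has_integral_sum has_integral_mult_right has_integral_log_difference)
     (auto simp: orthonormal_basis_finite)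

text \<open>The double sum over \<open>U'\<close>, \<open>V'\<close> is the relative entropy \<open>tr A (log A - log B)\<close>; the left-hand
  side is linear in \<open>(A, B)\<close>. Truncating the integral at \<open>R\<close> costs the term \<open>tr A / R\<close>.\<close>

lemma relative_entropy_ge_tangent:
  assumes "positive_diagonal_in A0 U a" "positive_diagonal_in B0 V b"
    and A: "positive_diagonal_in A U' a'" and B: "positive_diagonal_in B V' b'" and R: "0 < R"
  shows "entropy_tangent1 U a V b R A - entropy_tangent2 U a V b R B
     \<le> (\<Sum>u\<in>U'. \<Sum>v\<in>V'. (u \<bullet> v)\<^sup>2 * (a' u * (ln (a' u) - ln (b' v)))) + real_trace A / R"
proof -
  have dA: "diagonal_in A U' a'" and dB: "diagonal_in B V' b'"
    and lin: "linear A" "linear B" and ob: "orthonormal_basis V'"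
    using A B by (auto simp: positive_diagonal_in_def diagonal_in_def)
  have pos: "a' u > 0" "b' v > 0" if "u \<in> U'" "v \<in> V'" for u v
    using A B that by (auto simp: positive_diagonal_in_def)
  note int = integrable_entropy_integrand[OF assms(1,2)]
  have "entropy_tangent1 U a V b R A - entropy_tangent2 U a V b R B
      = integral {0..R} (\<lambda>s. entropy_integrand1 U a V b A s - entropy_integrand2 U a V b B s)"
    unfolding entropy_tangent1_def entropy_tangent2_def
    by (intro integral_diff[symmetric] int lin)
  also have "\<dots> \<le> (\<Sum>u\<in>U'. \<Sum>v\<in>V'. (u \<bullet> v)\<^sup>2 * (a' u * (ln (1 + R) - ln (a' u + R * b' v) + ln (a' u))))"
  proof (rule has_integral_le)
    show "((\<lambda>s. entropy_integrand1 U a V b A s - entropy_integrand2 U a V b B s) has_integral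
        integral {0..R} (\<lambda>s. entropy_integrand1 U a V b A s - entropy_integrand2 U a V b B s)) {0..R}"
      by (intro integrable_integral integrable_diff int lin)
    show "((\<lambda>s. \<Sum>u\<in>U'. \<Sum>v\<in>V'. (u \<bullet> v)\<^sup>2 * (a' u / (1 + s) - a' u * b' v / (a' u + s * b' v))) has_integral
     (\<Sum>u\<in>U'. \<Sum>v\<in>V'. (u \<bullet> v)\<^sup>2 * (a' u * (ln (1 + R) - ln (a' u + R * b' v) + ln (a' u))))) {0..R}"
      by (rule has_integral_relative_entropy[OF A B]) (use R in simp)
    fix s assume "s \<in> {0..R}"
    thus "entropy_integrand1 U a V b A s - entropy_integrand2 U a V b B s
       \<le> (\<Sum>u\<in>U'. \<Sum>v\<in>V'. (u \<bullet> v)\<^sup>2 * (a' u / (1 + s) - a' u * b' v / (a' u + s * b' v)))"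
      unfolding entropy_integrand_sum[OF dA dB]
      by (intro sum_mono) (simp only: right_diff_distrib, intro diff_left_mono parallel_sum_le pos; simp)
  qed
  also have "\<dots> \<le> (\<Sum>u\<in>U'. \<Sum>v\<in>V'. (u \<bullet> v)\<^sup>2 * (a' u * (ln (a' u) - ln (b' v)) + a' u / R))"
    by (intro sum_mono mult_left_mono log_difference_bounds(1) pos R) auto
  also have "\<dots> = (\<Sum>u\<in>U'. \<Sum>v\<in>V'. (u \<bullet> v)\<^sup>2 * (a' u * (ln (a' u) - ln (b' v)))) + real_trace A / R"
    by (simp add: distrib_left sum.distrib trace_double_sum[OF dA ob] sum_divide_distrib)
  finally show ?thesis .
qed

text \<open>Tangency: the map is tested in the bases that define it, its entries are the scalar
  minimisers, and \<open>parallel_sum_eq\<close> gives equality term by term. Only the truncation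
  loses something, and at a fixed base point this is a constant divided by \<open>R\<close>.\<close>

lemma relative_entropy_le_tangent:
  assumes A: "positive_diagonal_in A U a" and B: "positive_diagonal_in B V b" and R: "0 < R"
  shows "(\<Sum>u\<in>U. \<Sum>v\<in>V. (u \<bullet> v)\<^sup>2 * (a u * (ln (a u) - ln (b v))))
     - (\<Sum>u\<in>U. \<Sum>v\<in>V. (u \<bullet> v)\<^sup>2 * ((a u)\<^sup>2 / b v)) / R
     \<le> entropy_tangent1 U a V b R A - entropy_tangent2 U a V b R B"
proof -
  have dA: "diagonal_in A U a" and dB: "diagonal_in B V b" and lin: "linear A" "linear B"
    and ob: "orthonormal_basis U" "orthonormal_basis V"
    using A B by (auto simp: positive_diagonal_in_def diagonal_in_def)
  have pos: "a u > 0" "b v > 0" if "u \<in> U" "v \<in> V" for u v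
    using A B that by (auto simp: positive_diagonal_in_def)
  note int = integrable_entropy_integrand[OF A B]
  have "(\<Sum>u\<in>U. \<Sum>v\<in>V. (u \<bullet> v)\<^sup>2 * (a u * (ln (a u) - ln (b v))))
     - (\<Sum>u\<in>U. \<Sum>v\<in>V. (u \<bullet> v)\<^sup>2 * ((a u)\<^sup>2 / b v)) / R
     = (\<Sum>u\<in>U. \<Sum>v\<in>V. (u \<bullet> v)\<^sup>2 * (a u * (ln (a u) - ln (b v)) - (a u)\<^sup>2 / b v / R))"
    by (simp add: sum_subtractf right_diff_distrib sum_divide_distrib)
  also have "\<dots> \<le> (\<Sum>u\<in>U. \<Sum>v\<in>V. (u \<bullet> v)\<^sup>2 * (a u * (ln (1 + R) - ln (a u + R * b v) + ln (a u))))"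
    by (intro sum_mono mult_left_mono log_difference_bounds(2) pos R) auto
  also have "\<dots> \<le> integral {0..R} (\<lambda>s. entropy_integrand1 U a V b A s - entropy_integrand2 U a V b B s)"
  proof (rule has_integral_le)
    show "((\<lambda>s. entropy_integrand1 U a V b A s - entropy_integrand2 U a V b B s) has_integral
        integral {0..R} (\<lambda>s. entropy_integrand1 U a V b A s - entropy_integrand2 U a V b B s)) {0..R}"
      by (intro integrable_integral integrable_diff int lin)
    show "((\<lambda>s. \<Sum>u\<in>U. \<Sum>v\<in>V. (u \<bullet> v)\<^sup>2 * (a u / (1 + s) - a u * b v / (a u + s * b v))) has_integral
     (\<Sum>u\<in>U. \<Sum>v\<in>V. (u \<bullet> v)\<^sup>2 * (a u * (ln (1 + R) - ln (a u + R * b v) + ln (a u))))) {0..R}"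
      by (rule has_integral_relative_entropy[OF A B]) (use R in simp)
    fix s assume s: "s \<in> {0..R}"
    have "s * a u * (u \<bullet> psum_map U a V b s v)\<^sup>2 + b v * (u \<bullet> v - s * (u \<bullet> psum_map U a V b s v))\<^sup>2
        = (u \<bullet> v)\<^sup>2 * (a u * b v / (a u + s * b v))" if "u \<in> U" "v \<in> V" for u v
      unfolding psum_map_inner_basis[OF ob that]
      using pos[OF that] s by (intro parallel_sum_eq) auto
    thus "(\<Sum>u\<in>U. \<Sum>v\<in>V. (u \<bullet> v)\<^sup>2 * (a u / (1 + s) - a u * b v / (a u + s * b v)))
        \<le> entropy_integrand1 U a V b A s - entropy_integrand2 U a V b B s"
      unfolding entropy_integrand_sum[OF dA dB]
      by (intro sum_mono) (simp only: right_diff_distrib order_refl)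
  qed
  also have "\<dots> = entropy_tangent1 U a V b R A - entropy_tangent2 U a V b R B"
    unfolding entropy_tangent1_def entropy_tangent2_def
    by (intro integral_diff int lin)
  finally show ?thesis .
qed

section \<open>The matrix exponential\<close>

text \<open>Symmetry for the real inner product of \<open>complex^'d\<close>, which is the real part
  of the Hermitian one, so that the real spectral theorem applies.\<close>

definition symmetric_matrix :: "complex^'d^'d \<Rightarrow> bool" where
  "symmetric_matrix A \<longleftrightarrow> (\<forall>x y. (A *v x) \<bullet> y = x \<bullet> (A *v y))"

lemma scaleR_matrix_vector: "(c *\<^sub>R A) *v x = c *\<^sub>R (A *v x)" for A :: "complex^'d^'d"
  by (simp add: vec_eq_iff matrix_vector_mult_def scaleR_sum_right)

lemma linear_matrix_apply: "linear (\<lambda>A :: complex^'d^'d. A *v x)" for x :: "complex^'d"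
  by (intro linearI) (simp_all add: scaleR_matrix_vector matrix_vector_mult_add_rdistrib)

lemma bounded_linear_matrix_apply: "bounded_linear (\<lambda>A :: complex^'d^'d. A *v x)" for x :: "complex^'d"
  using linear_matrix_apply linear_conv_bounded_linear by blast

lemma bounded_bilinear_matrix_mult: "bounded_bilinear (\<lambda>(A :: complex^'d^'d) (B :: complex^'d^'d). A ** B)"
  by (simp add: bilinear_def linear_iff vec_eq_iff matrix_matrix_mult_def sum.distrib scaleR_sum_right
        distrib_left distrib_right flip: bilinear_conv_bounded_bilinear)

lemma symmetric_matrix_add: "symmetric_matrix A \<Longrightarrow> symmetric_matrix B \<Longrightarrow> symmetric_matrix (A + B)"
  by (simp add: symmetric_matrix_def matrix_vector_mult_add_rdistrib inner_add_left inner_add_right)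

lemma symmetric_matrix_scaleR: "symmetric_matrix A \<Longrightarrow> symmetric_matrix (c *\<^sub>R A)"
  by (simp add: symmetric_matrix_def scaleR_matrix_vector)

lemma symmetric_matrix_zero: "symmetric_matrix 0"
  by (simp add: symmetric_matrix_def)

lemma symmetric_matrix_sum: "(\<And>i. i \<in> I \<Longrightarrow> symmetric_matrix (A i)) \<Longrightarrow> symmetric_matrix (\<Sum>i\<in>I. A i)"
  by (induction I rule: infinite_finite_induct) (auto intro: symmetric_matrix_add symmetric_matrix_zero)

lemma symmetric_matrix_square: "symmetric_matrix A \<Longrightarrow> symmetric_matrix (A ** A)"
  by (simp add: symmetric_matrix_def flip: matrix_vector_mul_assoc)

lemma symmetric_matrix_eigenbasis:
  fixes A :: "complex^'d^'d"
  assumes "symmetric_matrix A"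
  obtains U a where "diagonal_in ((*v) A) U a"
  by (rule spectral_theorem[of "(*v) A"]) (use assms in \<open>auto simp: symmetric_matrix_def\<close>)

primrec matrix_power :: "complex^'d^'d \<Rightarrow> nat \<Rightarrow> complex^'d^'d" where
  "matrix_power A 0 = mat 1"
| "matrix_power A (Suc k) = A ** matrix_power A k"

text \<open>A power series rather than a diagonalisation: measurability in the matrix follows
  termwise, with no measurable choice of eigenbasis, and a norm bound comes with it.\<close>

definition matrix_exp :: "complex^'d^'d \<Rightarrow> complex^'d^'d" where
  "matrix_exp A = (\<Sum>k. (1 / fact k) *\<^sub>R matrix_power A k)"

lemma matrix_power_norm_bound:
  "\<exists>K>0. \<forall>(A :: complex^'d^'d) k. norm (matrix_power A k) \<le> norm (mat 1 :: complex^'d^'d) * (K * norm A) ^ k"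
proof -
  obtain K where K: "K > 0" "\<And>(A :: complex^'d^'d) (B :: complex^'d^'d). norm (A ** B) \<le> norm A * norm B * K"
    using bounded_bilinear.pos_bounded[OF bounded_bilinear_matrix_mult] by blast
  have "norm (matrix_power A k) \<le> norm (mat 1 :: complex^'d^'d) * (K * norm A) ^ k" for A :: "complex^'d^'d" and k
  proof (induction k)
    case (Suc k)
    have "norm (matrix_power A (Suc k)) \<le> norm A * norm (matrix_power A k) * K"
      unfolding matrix_power.simps by (rule K(2))
    also have "\<dots> \<le> norm A * (norm (mat 1 :: complex^'d^'d) * (K * norm A) ^ k) * K"
      using Suc K(1) by (intro mult_left_mono mult_right_mono) auto
    finally show ?case by (simp add: mult_ac)
  qed simp
  thus ?thesis using K(1) by blast
qed

lemma matrix_exp_bound: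
  "\<exists>K>0. \<forall>A :: complex^'d^'d. summable (\<lambda>k. (1 / fact k) *\<^sub>R matrix_power A k)
    \<and> norm (matrix_exp A) \<le> norm (mat 1 :: complex^'d^'d) * exp (K * norm A)"
proof -
  let ?N = "norm (mat 1 :: complex^'d^'d)"
  obtain K where K: "\<And>(A :: complex^'d^'d) k. norm (matrix_power A k) \<le> ?N * (K * norm A) ^ k" "0 < K"
    using matrix_power_norm_bound by blast
  have le: "norm ((1 / fact k) *\<^sub>R matrix_power A k) \<le> ?N * ((K * norm A) ^ k /\<^sub>R fact k)"
    for A :: "complex^'d^'d" and k
    using K(1)[of A k] by (simp add: divide_simps)
  have sm: "(\<lambda>k. ?N * ((K * norm A) ^ k /\<^sub>R fact k)) sums (?N * exp (K * norm A))" for A :: "complex^'d^'d"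
    by (intro sums_mult exp_converges)
  have 1: "summable (\<lambda>k. norm ((1 / fact k) *\<^sub>R matrix_power A k))" for A :: "complex^'d^'d"
    by (rule summable_comparison_test'[OF sums_summable[OF sm[of A]], of 0]) (use le in auto)
  have "norm (matrix_exp A) \<le> ?N * exp (K * norm A)" for A :: "complex^'d^'d"
  proof -
    have "norm (matrix_exp A) \<le> (\<Sum>k. norm ((1 / fact k) *\<^sub>R matrix_power A k))"
      unfolding matrix_exp_def by (rule summable_norm[OF 1])
    also have "\<dots> \<le> (\<Sum>k. ?N * ((K * norm A) ^ k /\<^sub>R fact k))"
      by (rule suminf_le[OF le 1 sums_summable[OF sm]])
    also have "\<dots> = ?N * exp (K * norm A)" using sm by (simp add: sums_iff)
    finally show ?thesis .
  qed
  thus ?thesis using summable_norm_cancel[OF 1] K(2) by blast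
qed

lemma matrix_exp_eigenvector:
  fixes A :: "complex^'d^'d"
  assumes "A *v x = l *\<^sub>R x"
  shows "matrix_exp A *v x = exp l *\<^sub>R x"
proof -
  have p: "matrix_power A k *v x = (l ^ k) *\<^sub>R x" for k
  proof (induction k)
    case (Suc k)
    have "matrix_power A (Suc k) *v x = A *v ((l ^ k) *\<^sub>R x)"
      using Suc by (simp flip: matrix_vector_mul_assoc)
    also have "\<dots> = (l ^ Suc k) *\<^sub>R x"
      using assms by (simp add: linear_scale[OF matrix_vector_mul_linear] mult.commute)
    finally show ?case .
  qed simp
  have "summable (\<lambda>k. (1 / fact k) *\<^sub>R matrix_power A k)"
    using matrix_exp_bound by blast
  hence "(\<lambda>k. (1 / fact k) *\<^sub>R matrix_power A k) sums matrix_exp A"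
    unfolding matrix_exp_def by (rule summable_sums)
  from bounded_linear.sums[OF bounded_linear_matrix_apply this, of x]
  have "(\<lambda>k. (l ^ k /\<^sub>R fact k) *\<^sub>R x) sums (matrix_exp A *v x)"
    by (simp add: scaleR_matrix_vector p divide_inverse mult.commute)
  moreover have "(\<lambda>k. (l ^ k /\<^sub>R fact k) *\<^sub>R x) sums (exp l *\<^sub>R x)"
    by (rule bounded_linear.sums[OF bounded_linear_scaleR_left exp_converges])
  ultimately show ?thesis by (rule sums_unique2)
qed

lemma matrix_exp_diagonal:
  assumes "diagonal_in ((*v) A) U a"
  shows "positive_diagonal_in ((*v) (matrix_exp A)) U (\<lambda>u. exp (a u))"
  using assms by (auto simp: positive_diagonal_in_def diagonal_in_def intro!: matrix_exp_eigenvector)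

lemma diagonal_symmetric_matrix:
  assumes "diagonal_in ((*v) A) U a"
  shows "symmetric_matrix A"
  unfolding symmetric_matrix_def
proof (intro allI)
  fix x y
  have "(A *v x) \<bullet> y = y \<bullet> (A *v x)" by (rule inner_commute)
  also have "\<dots> = x \<bullet> (A *v y)"
    unfolding diagonal_in_inner[OF assms] by (simp add: mult_ac)
  finally show "(A *v x) \<bullet> y = x \<bullet> (A *v y)" .
qed

lemma symmetric_matrix_exp: "symmetric_matrix A \<Longrightarrow> symmetric_matrix (matrix_exp A)"
  by (metis symmetric_matrix_eigenbasis matrix_exp_diagonal positive_diagonal_in_def diagonal_symmetric_matrix)

text \<open>Strictness matters: it survives the expectation, and logarithms of the eigenvalues of
  the averaged matrix are taken later.\<close>

lemma matrix_exp_positive: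
  assumes "symmetric_matrix A" "x \<noteq> 0"
  shows "0 < x \<bullet> (matrix_exp A *v x)"
proof -
  obtain U a where U: "diagonal_in ((*v) A) U a"
    using symmetric_matrix_eigenbasis[OF assms(1)] .
  hence d: "diagonal_in ((*v) (matrix_exp A)) U (\<lambda>u. exp (a u))"
    using matrix_exp_diagonal positive_diagonal_in_def by blast
  have ob: "orthonormal_basis U" using U by (simp add: diagonal_in_def)
  have "(norm x)\<^sup>2 \<noteq> 0" using assms(2) by simp
  then obtain u where u: "u \<in> U" "(u \<bullet> x)\<^sup>2 \<noteq> 0"
    unfolding orthonormal_basis_norm[OF ob] by (meson sum.neutral)
  have "0 < (\<Sum>u\<in>U. exp (a u) * (u \<bullet> x)\<^sup>2)"
    by (rule sum_pos2[OF orthonormal_basis_finite[OF ob] u(1)]) (use u(2) in auto)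
  thus ?thesis
    by (simp add: diagonal_in_inner[OF d] power2_eq_square mult_ac)
qed

section \<open>Measurability of matrix functions\<close>

lemma measurable_matrix_mult [measurable]:
  fixes f g :: "'w \<Rightarrow> complex^'d^'d"
  assumes "f \<in> borel_measurable M" "g \<in> borel_measurable M"
  shows "(\<lambda>w. f w ** g w) \<in> borel_measurable M"
proof -
  have "(\<lambda>p. (case p of (A :: complex^'d^'d, B :: complex^'d^'d) \<Rightarrow> A ** B)) \<in> borel_measurable borel"
    unfolding case_prod_unfold
    by (intro borel_measurable_continuous_onI bounded_bilinear.continuous_on[OF bounded_bilinear_matrix_mult]
         continuous_intros)
  hence "(\<lambda>w. case (f w, g w) of (A, B) \<Rightarrow> A ** B) \<in> borel_measurable M"
    by (rule measurable_compose[rotated]) (use assms in measurable)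
  thus ?thesis by simp
qed

lemma measurable_matrix_exp [measurable]:
  "(matrix_exp :: complex^'d^'d \<Rightarrow> _) \<in> borel_measurable borel"
proof -
  have [measurable]: "(\<lambda>A :: complex^'d^'d. matrix_power A k) \<in> borel_measurable borel" for k
    by (induction k) simp_all
  show ?thesis unfolding matrix_exp_def by measurable
qed

section \<open>The one-step trace inequality\<close>

abbreviation mtrace :: "complex^'d^'d \<Rightarrow> real" where
  "mtrace A \<equiv> real_trace ((*v) A)"

lemma linear_mtrace: "linear mtrace"
  by (intro linearI) (simp_all add: real_trace_def scaleR_matrix_vector matrix_vector_mult_add_rdistrib
       inner_add_right sum.distrib sum_distrib_left)

lemma bounded_linear_mtrace: "bounded_linear mtrace"
  using linear_mtrace linear_conv_bounded_linear by blast

text \<open>Evaluated in \<open>U\<close>, the trace replaces \<open>A\<close> by its eigenvalues;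
  expanding the quadratic form of \<open>B\<close> in \<open>V\<close> then gives the weights. This
  converts double sums back into traces.\<close>

lemma trace_product:
  assumes "diagonal_in A U a" "diagonal_in B V b"
  shows "(\<Sum>u\<in>U. \<Sum>v\<in>V. (u \<bullet> v)\<^sup>2 * (a u * b v)) = real_trace (\<lambda>x. B (A x))"
proof -
  have lin: "linear A" "linear B" and U: "orthonormal_basis U"
    using assms by (auto simp: diagonal_in_def)
  have "real_trace (\<lambda>x. B (A x)) = (\<Sum>u\<in>U. u \<bullet> B (A u))"
    using linear_compose[OF lin] by (intro real_trace_basis U) (simp add: o_def)
  also have "\<dots> = (\<Sum>u\<in>U. a u * (u \<bullet> B u))"
    by (intro sum.cong refl) (simp add: diagonal_in_eigen[OF assms(1)] linear_scale[OF lin(2)])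
  also have "\<dots> = (\<Sum>u\<in>U. \<Sum>v\<in>V. (u \<bullet> v)\<^sup>2 * (a u * b v))"
    by (simp add: diagonal_in_inner[OF assms(2)] sum_distrib_left power2_eq_square inner_commute mult_ac)
  finally show ?thesis by simp
qed

text \<open>The Gibbs variational principle. Expanded with weights (u . w)^2 it is the scalar
  inequality t + t g - t ln t <= exp g, which is 1 + z <= exp z at z = g - ln t, multiplied by
  t.\<close>

lemma klein_inequality:
  assumes T: "positive_diagonal_in T U t" and G: "diagonal_in ((*v) G) W g"
  shows "real_trace T + real_trace (\<lambda>x. G *v T x) - (\<Sum>u\<in>U. t u * ln (t u)) \<le> mtrace (matrix_exp G)"
proof -
  have dT: "diagonal_in T U t" and ob: "orthonormal_basis U" "orthonormal_basis W"
    using T G by (auto simp: positive_diagonal_in_def diagonal_in_def)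
  have dE: "diagonal_in ((*v) (matrix_exp G)) W (\<lambda>w. exp (g w))"
    using matrix_exp_diagonal[OF G] by (simp add: positive_diagonal_in_def)
  have one: "(\<Sum>w\<in>W. (u \<bullet> w)\<^sup>2) = 1" if "u \<in> U" for u
    using orthonormal_basis_norm[OF ob(2), of u] diagonal_in_eigen[OF dT that]
    by (simp add: inner_commute)
  have "(\<Sum>u\<in>U. t u * ln (t u)) = (\<Sum>u\<in>U. \<Sum>w\<in>W. (u \<bullet> w)\<^sup>2 * (t u * ln (t u)))"
    by (simp add: one flip: sum_distrib_right)
  hence "real_trace T + real_trace (\<lambda>x. G *v T x) - (\<Sum>u\<in>U. t u * ln (t u))
     = (\<Sum>u\<in>U. \<Sum>w\<in>W. (u \<bullet> w)\<^sup>2 * (t u + t u * g w - t u * ln (t u)))"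
    by (simp add: trace_double_sum[OF dT ob(2)] flip: trace_product[OF dT G])
       (simp add: sum.distrib sum_subtractf distrib_left right_diff_distrib)
  also have "\<dots> \<le> (\<Sum>u\<in>U. \<Sum>w\<in>W. (u \<bullet> w)\<^sup>2 * exp (g w))"
  proof (intro sum_mono mult_left_mono)
    fix u w assume "u \<in> U"
    hence t: "t u > 0" using T by (simp add: positive_diagonal_in_def)
    have "t u * (1 + (g w - ln (t u))) \<le> t u * exp (g w - ln (t u))"
      using t by (intro mult_left_mono) auto
    also have "\<dots> = exp (g w)" using t by (simp add: exp_diff)
    finally show "t u + t u * g w - t u * ln (t u) \<le> exp (g w)" by (simp add: algebra_simps)
  qed simp
  also have "\<dots> = (\<Sum>w\<in>W. \<Sum>u\<in>U. (w \<bullet> u)\<^sup>2 * exp (g w))"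
    by (subst sum.swap) (simp add: inner_commute)
  also have "\<dots> = mtrace (matrix_exp G)"
    by (rule trace_double_sum[OF dE ob(1), symmetric])
  finally show ?thesis .
qed

lemma le_of_le_add_divide:
  fixes x y C :: real
  assumes "\<And>R. 0 < R \<Longrightarrow> x \<le> y + C / R"
  shows "x \<le> y"
proof (rule field_le_epsilon)
  fix e :: real assume e: "e > 0"
  have "x \<le> y + C / ((\<bar>C\<bar> + 1) / e)" using e by (intro assms) simp
  also have "C / ((\<bar>C\<bar> + 1) / e) \<le> e" using e by (simp add: field_simps abs_if)
  finally show "x \<le> y + e" by simp
qed

text \<open>With the base point fixed, the functionals therefore commute with the Bochner integral;
  this takes the place of an operator Jensen inequality.\<close>

lemma bounded_linear_entropy_tangent:
  assumes "positive_diagonal_in A U a" "positive_diagonal_in B V b"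
  shows "bounded_linear (\<lambda>F :: complex^'d^'d. entropy_tangent1 U a V b R ((*v) F))"
    and "bounded_linear (\<lambda>F :: complex^'d^'d. entropy_tangent2 U a V b R ((*v) F))"
proof -
  have lin: "linear ((*v) F)" for F :: "complex^'d^'d" by simp
  have add: "(*v) (F + G) = (\<lambda>x. F *v x + G *v x)" for F G :: "complex^'d^'d"
    by (simp add: fun_eq_iff matrix_vector_mult_add_rdistrib)
  have scl: "(*v) (c *\<^sub>R F) = (\<lambda>x. c *\<^sub>R (F *v x))" for F :: "complex^'d^'d" and c
    by (simp add: fun_eq_iff scaleR_matrix_vector)
  show "bounded_linear (\<lambda>F :: complex^'d^'d. entropy_tangent1 U a V b R ((*v) F))"
    "bounded_linear (\<lambda>F :: complex^'d^'d. entropy_tangent2 U a V b R ((*v) F))"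
    unfolding linear_conv_bounded_linear[symmetric]
    by (intro linearI; simp add: add scl entropy_tangent_add[OF assms lin lin] entropy_tangent_scale)+
qed

text \<open>For A = exp (H + X) and B = exp X the logarithms differ by exactly \<open>H\<close>, so
  the relative entropy is tr (H A), linear in A once \<open>H\<close> is fixed.\<close>

lemma entropy_tangent_exp_le:
  assumes "positive_diagonal_in A0 U a" "positive_diagonal_in B0 V b"
    and H: "symmetric_matrix H" and X: "symmetric_matrix X" and R: "0 < R"
  shows "entropy_tangent1 U a V b R ((*v) (matrix_exp (H + X))) - entropy_tangent2 U a V b R ((*v) (matrix_exp X))
     \<le> mtrace (H ** matrix_exp (H + X)) + mtrace (matrix_exp (H + X)) / R"
proof -
  obtain U' p where P: "diagonal_in ((*v) (H + X)) U' p"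
    using symmetric_matrix_eigenbasis[OF symmetric_matrix_add[OF H X]] .
  obtain V' q where Q: "diagonal_in ((*v) X) V' q"
    using symmetric_matrix_eigenbasis[OF X] .
  let ?T = "matrix_exp (H + X)"
  note eP = matrix_exp_diagonal[OF P] and eQ = matrix_exp_diagonal[OF Q]
  have dP: "diagonal_in ((*v) ?T) U' (\<lambda>u. exp (p u))"
    using eP by (simp add: positive_diagonal_in_def)
  have ob: "orthonormal_basis U'" "orthonormal_basis V'" using P Q by (auto simp: diagonal_in_def)
  have "mtrace (H ** ?T) = (\<Sum>u\<in>U'. u \<bullet> (H *v (?T *v u)))"
    by (subst real_trace_basis[OF _ ob(1)]) (simp_all add: matrix_vector_mul_assoc)
  also have "\<dots> = (\<Sum>u\<in>U'. exp (p u) * (p u - u \<bullet> (X *v u)))"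
  proof (intro sum.cong refl)
    fix u assume u: "u \<in> U'"
    \<comment> \<open>This is the identity H = log A - log B, read off on an eigenvector of H + X;
      the quadratic form of \<open>X\<close> is then expanded in its own eigenbasis.\<close>
    have "H *v u = p u *\<^sub>R u - X *v u"
      using diagonal_in_eigen(1)[OF P u] by (simp add: matrix_vector_mult_add_rdistrib eq_diff_eq)
    thus "u \<bullet> (H *v (?T *v u)) = exp (p u) * (p u - u \<bullet> (X *v u))"
      using diagonal_in_eigen[OF dP u]
      by (simp add: linear_scale[OF matrix_vector_mul_linear] inner_diff_right)
  qed
  also have "\<dots> = (\<Sum>u\<in>U'. \<Sum>v\<in>V'. (u \<bullet> v)\<^sup>2 * (exp (p u) * (p u - q v)))"
  proof (intro sum.cong refl)
    fix u assume u: "u \<in> U'"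
    have one: "(\<Sum>v\<in>V'. (u \<bullet> v)\<^sup>2) = 1"
      using orthonormal_basis_norm[OF ob(2), of u] diagonal_in_eigen[OF P u]
      by (simp add: inner_commute)
    have "(\<Sum>v\<in>V'. (u \<bullet> v)\<^sup>2 * (exp (p u) * (p u - q v)))
       = (\<Sum>v\<in>V'. (u \<bullet> v)\<^sup>2) * (exp (p u) * p u) - exp (p u) * (\<Sum>v\<in>V'. q v * (v \<bullet> u) * (v \<bullet> u))"
      by (simp add: sum_distrib_left sum_distrib_right power2_eq_square inner_commute algebra_simps sum_subtractf)
    also have "\<dots> = exp (p u) * (p u - u \<bullet> (X *v u))"
      unfolding one diagonal_in_inner[OF Q] by (simp add: algebra_simps)
    finally show "exp (p u) * (p u - u \<bullet> (X *v u)) = (\<Sum>v\<in>V'. (u \<bullet> v)\<^sup>2 * (exp (p u) * (p u - q v)))" ..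
  qed
  finally show ?thesis
    using relative_entropy_ge_tangent[OF assms(1,2) eP eQ R] by simp
qed

context prob_space
begin

lemma integrable_matrix_exp:
  fixes X :: "'a \<Rightarrow> complex^'d^'d"
  assumes [measurable]: "X \<in> borel_measurable M" and b: "AE \<omega> in M. norm (X \<omega>) \<le> C"
  shows "integrable M (\<lambda>\<omega>. matrix_exp (X \<omega>))"
proof -
  obtain K where K: "\<forall>A :: complex^'d^'d. norm (matrix_exp A) \<le> norm (mat 1 :: complex^'d^'d) * exp (K * norm A)" "0 < K"
    using matrix_exp_bound by blast
  show ?thesis
  proof (rule integrable_const_bound[where B="norm (mat 1 :: complex^'d^'d) * exp (K * C)"])
    show "AE \<omega> in M. norm (matrix_exp (X \<omega>)) \<le> norm (mat 1 :: complex^'d^'d) * exp (K * C)"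
      using b
    proof eventually_elim
      case (elim \<omega>)
      have "norm (mat 1 :: complex^'d^'d) * exp (K * norm (X \<omega>)) \<le> norm (mat 1 :: complex^'d^'d) * exp (K * C)"
        using elim K(2) by (intro mult_left_mono) auto
      thus ?case using K(1) by (meson order_trans)
    qed
  qed measurable
qed

lemma inner_expectation_matrix:
  fixes T :: "'a \<Rightarrow> complex^'d^'d"
  assumes "integrable M T"
  shows "x \<bullet> (expectation T *v y) = expectation (\<lambda>\<omega>. x \<bullet> (T \<omega> *v y))"
    and "integrable M (\<lambda>\<omega>. x \<bullet> (T \<omega> *v y))"
proof -
  have "bounded_linear (\<lambda>A :: complex^'d^'d. x \<bullet> (A *v y))"
    by (rule bounded_linear_compose[OF bounded_linear_inner_right bounded_linear_matrix_apply])
  from integral_bounded_linear[OF this assms] integrable_bounded_linear[OF this assms]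
  show "x \<bullet> (expectation T *v y) = expectation (\<lambda>\<omega>. x \<bullet> (T \<omega> *v y))"
    "integrable M (\<lambda>\<omega>. x \<bullet> (T \<omega> *v y))" by simp_all
qed

lemma symmetric_matrix_expectation:
  fixes T :: "'a \<Rightarrow> complex^'d^'d"
  assumes "integrable M T" "\<And>\<omega>. \<omega> \<in> space M \<Longrightarrow> symmetric_matrix (T \<omega>)"
  shows "symmetric_matrix (expectation T)"
  unfolding symmetric_matrix_def
proof (intro allI)
  fix x y
  have "(expectation T *v x) \<bullet> y = expectation (\<lambda>\<omega>. y \<bullet> (T \<omega> *v x))"
    by (simp add: inner_commute[of _ y] inner_expectation_matrix[OF assms(1)])
  also have "\<dots> = expectation (\<lambda>\<omega>. x \<bullet> (T \<omega> *v y))"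
    using assms(2) by (intro Bochner_Integration.integral_cong) (auto simp: symmetric_matrix_def inner_commute)
  also have "\<dots> = x \<bullet> (expectation T *v y)"
    by (simp add: inner_expectation_matrix[OF assms(1)])
  finally show "(expectation T *v x) \<bullet> y = x \<bullet> (expectation T *v y)" .
qed

text \<open>A form of Lieb's concavity theorem: by the tangent bound for the relative entropy, and
  then by the variational formula for \<open>tr exp\<close> (Klein's inequality).\<close>

lemma expectation_trace_exp_le:
  fixes X :: "'a \<Rightarrow> complex^'d^'d" and H V :: "complex^'d^'d"
  assumes H: "symmetric_matrix H" and V: "symmetric_matrix V"
    and X [measurable]: "X \<in> borel_measurable M" and b: "AE \<omega> in M. norm (X \<omega>) \<le> C"
    and sym: "\<And>\<omega>. \<omega> \<in> space M \<Longrightarrow> symmetric_matrix (X \<omega>)"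
    and mgf: "\<And>x. x \<bullet> (expectation (\<lambda>\<omega>. matrix_exp (X \<omega>)) *v x) \<le> x \<bullet> (matrix_exp V *v x)"
  shows "expectation (\<lambda>\<omega>. mtrace (matrix_exp (H + X \<omega>))) \<le> mtrace (matrix_exp (H + V))"
    and "integrable M (\<lambda>\<omega>. mtrace (matrix_exp (H + X \<omega>)))"
proof -
  define T where "T = (\<lambda>\<omega>. matrix_exp (H + X \<omega>))"
  define Tb where "Tb = expectation T"
  have intX: "integrable M (\<lambda>\<omega>. matrix_exp (X \<omega>))"
    by (rule integrable_matrix_exp[OF X b])
  have "AE \<omega> in M. norm (H + X \<omega>) \<le> norm H + C"
    using b by eventually_elim (rule norm_triangle_le, simp)
  hence intT: "integrable M T"
    unfolding T_def by (intro integrable_matrix_exp) auto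
  show int_tr: "integrable M (\<lambda>\<omega>. mtrace (matrix_exp (H + X \<omega>)))"
    using integrable_bounded_linear[OF bounded_linear_mtrace intT] by (simp add: T_def)
  have symT: "symmetric_matrix (H + X \<omega>)" if "\<omega> \<in> space M" for \<omega>
    using symmetric_matrix_add[OF H sym[OF that]] .
  have "symmetric_matrix Tb"
    unfolding Tb_def using symT by (intro symmetric_matrix_expectation intT) (auto simp: T_def intro: symmetric_matrix_exp)
  then obtain U t where U: "diagonal_in ((*v) Tb) U t"
    by (rule symmetric_matrix_eigenbasis)
  \<comment> \<open>\<open>Tb\<close> and exp V form the base point of the tangent functional, which
    needs positive eigenvalues.\<close>
  have Tpos: "positive_diagonal_in ((*v) Tb) U t"
    unfolding positive_diagonal_in_def
  proof (intro conjI U ballI)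
    fix u assume u: "u \<in> U"
    have nz: "u \<noteq> 0" using diagonal_in_eigen(2)[OF U u] by auto
    have pos: "0 < u \<bullet> (T \<omega> *v u)" if "\<omega> \<in> space M" for \<omega>
      unfolding T_def by (rule matrix_exp_positive[OF symT[OF that] nz])
    have "t u = u \<bullet> (Tb *v u)"
      using diagonal_in_eigen[OF U u] by simp
    also have "\<dots> = expectation (\<lambda>\<omega>. u \<bullet> (T \<omega> *v u))"
      unfolding Tb_def by (rule inner_expectation_matrix[OF intT])
    also have "\<dots> > 0"
    proof -
      have ge: "AE \<omega> in M. 0 \<le> u \<bullet> (T \<omega> *v u)" using pos by (auto intro!: AE_I2 less_imp_le)
      have "expectation (\<lambda>\<omega>. u \<bullet> (T \<omega> *v u)) \<noteq> 0"
      proof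
        assume "expectation (\<lambda>\<omega>. u \<bullet> (T \<omega> *v u)) = 0"
        hence "AE \<omega> in M. u \<bullet> (T \<omega> *v u) = 0"
          using integral_nonneg_eq_0_iff_AE[OF inner_expectation_matrix(2)[OF intT] ge] by simp
        hence "AE \<omega> in M. False"
          using AE_space by eventually_elim (use pos in force)
        thus False by simp
      qed
      thus ?thesis using integral_nonneg_AE[OF ge] by linarith
    qed
    finally show "0 < t u" .
  qed
  obtain W v where W: "diagonal_in ((*v) V) W v"
    using symmetric_matrix_eigenbasis[OF V] .
  note eV = matrix_exp_diagonal[OF W]
  have ob: "orthonormal_basis U" "orthonormal_basis W" using U W by (auto simp: diagonal_in_def)
  \<comment> \<open>The truncation coefficient at the base point; it does not depend on
    \<open>R\<close>.\<close>
  let ?C = "\<Sum>u\<in>U. \<Sum>w\<in>W. (u \<bullet> w)\<^sup>2 * ((t u)\<^sup>2 / exp (v w))"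
  have "(\<Sum>u\<in>U. \<Sum>w\<in>W. (u \<bullet> w)\<^sup>2 * (t u * (ln (t u) - v w))) \<le> mtrace (H ** Tb)"
  proof (rule le_of_le_add_divide)
    fix R :: real assume R: "0 < R"
    let ?e1 = "\<lambda>F :: complex^'d^'d. entropy_tangent1 U t W (\<lambda>w. exp (v w)) R ((*v) F)"
    let ?e2 = "\<lambda>F :: complex^'d^'d. entropy_tangent2 U t W (\<lambda>w. exp (v w)) R ((*v) F)"
    note bl = bounded_linear_entropy_tangent[OF Tpos eV, of R]
    have blH: "bounded_linear (\<lambda>F. mtrace (H ** F) + mtrace F / R)"
      by (intro bounded_linear_add bounded_linear_divide bounded_linear_compose[OF bounded_linear_divide]
           bounded_linear_compose[OF bounded_linear_mtrace] bounded_linear_mtrace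
           bounded_bilinear.bounded_linear_right[OF bounded_bilinear_matrix_mult])
    have "(\<Sum>u\<in>U. \<Sum>w\<in>W. (u \<bullet> w)\<^sup>2 * (t u * (ln (t u) - v w))) - ?C / R \<le> ?e1 Tb - ?e2 (matrix_exp V)"
      using relative_entropy_le_tangent[OF Tpos eV R] by simp
    also have "\<dots> \<le> ?e1 Tb - ?e2 (expectation (\<lambda>\<omega>. matrix_exp (X \<omega>)))"
      by (intro diff_left_mono entropy_tangent2_mono[OF Tpos eV] mgf) auto
    also have "\<dots> = expectation (\<lambda>\<omega>. ?e1 (T \<omega>)) - expectation (\<lambda>\<omega>. ?e2 (matrix_exp (X \<omega>)))"
      unfolding Tb_def using integral_bounded_linear[OF bl(1) intT] integral_bounded_linear[OF bl(2) intX] by simp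
    also have "\<dots> = expectation (\<lambda>\<omega>. ?e1 (T \<omega>) - ?e2 (matrix_exp (X \<omega>)))"
      by (intro Bochner_Integration.integral_diff[symmetric] integrable_bounded_linear[OF bl(1) intT]
            integrable_bounded_linear[OF bl(2) intX])
    also have "\<dots> \<le> expectation (\<lambda>\<omega>. mtrace (H ** T \<omega>) + mtrace (T \<omega>) / R)"
    proof (rule integral_mono)
      show "?e1 (T \<omega>) - ?e2 (matrix_exp (X \<omega>)) \<le> mtrace (H ** T \<omega>) + mtrace (T \<omega>) / R" if "\<omega> \<in> space M" for \<omega>
        unfolding T_def by (rule entropy_tangent_exp_le[OF Tpos eV H sym[OF that] R])
    qed (intro Bochner_Integration.integrable_diff integrable_bounded_linear[OF bl(1) intT]
            integrable_bounded_linear[OF bl(2) intX] integrable_bounded_linear[OF blH intT])+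
    also have "\<dots> = mtrace (H ** Tb) + mtrace Tb / R"
      unfolding Tb_def by (rule integral_bounded_linear[OF blH intT])
    finally show "(\<Sum>u\<in>U. \<Sum>w\<in>W. (u \<bullet> w)\<^sup>2 * (t u * (ln (t u) - v w))) \<le> mtrace (H ** Tb) + (mtrace Tb + ?C) / R"
      by (simp add: add_divide_distrib)
  qed
  moreover have "(\<Sum>u\<in>U. \<Sum>w\<in>W. (u \<bullet> w)\<^sup>2 * (t u * (ln (t u) - v w)))
      = (\<Sum>u\<in>U. t u * ln (t u)) - mtrace (V ** Tb)"
  proof -
    have one: "(\<Sum>w\<in>W. (u \<bullet> w)\<^sup>2) = 1" if "u \<in> U" for u
      using orthonormal_basis_norm[OF ob(2), of u] diagonal_in_eigen[OF U that]
      by (simp add: inner_commute)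
    have "(\<Sum>u\<in>U. \<Sum>w\<in>W. (u \<bullet> w)\<^sup>2 * (t u * (ln (t u) - v w)))
      = (\<Sum>u\<in>U. (\<Sum>w\<in>W. (u \<bullet> w)\<^sup>2) * (t u * ln (t u))) - (\<Sum>u\<in>U. \<Sum>w\<in>W. (u \<bullet> w)\<^sup>2 * (t u * v w))"
      by (simp add: sum_distrib_right sum_subtractf right_diff_distrib)
    thus ?thesis
      by (simp add: one trace_product[OF U W] matrix_vector_mul_assoc)
  qed
  ultimately have "(\<Sum>u\<in>U. t u * ln (t u)) \<le> mtrace ((H + V) ** Tb)"
    by (simp add: linear_add[OF linear_mtrace] bounded_bilinear.add_left[OF bounded_bilinear_matrix_mult])
  moreover obtain Z g where G: "diagonal_in ((*v) (H + V)) Z g"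
    using symmetric_matrix_eigenbasis[OF symmetric_matrix_add[OF H V]] .
  \<comment> \<open>Klein's inequality with G = H + V: the preceding bound says that tr (G Tb) - tr
    (Tb log Tb) is nonnegative, so dropping it leaves tr Tb.\<close>
  ultimately have "mtrace Tb \<le> mtrace (matrix_exp (H + V))"
    using klein_inequality[OF Tpos G] by (simp add: matrix_vector_mul_assoc)
  also have "mtrace Tb = expectation (\<lambda>\<omega>. mtrace (matrix_exp (H + X \<omega>)))"
    unfolding Tb_def T_def[symmetric]
    using integral_bounded_linear[OF bounded_linear_mtrace intT] by (simp add: T_def)
  finally show "expectation (\<lambda>\<omega>. mtrace (matrix_exp (H + X \<omega>))) \<le> mtrace (matrix_exp (H + V))" .
qed

end

section \<open>The operator norm and moments\<close>

lemma op_norm_bound: "norm (A *v x) \<le> op_norm A * norm x"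
  unfolding op_norm_def by (rule onorm) simp

lemma op_norm_nonneg: "0 \<le> op_norm A"
  unfolding op_norm_def by (rule onorm_pos_le) simp

lemma op_norm_eq_0: "op_norm A = 0 \<longleftrightarrow> A = 0" for A :: "complex^'a^'a"
proof
  assume "op_norm A = 0"
  hence "A *v x = 0" for x using op_norm_bound[of A x] by simp
  thus "A = 0" by (metis matrix_eq matrix_vector_mult_0)
next
  assume "A = 0"
  moreover have "(*v) (0 :: complex^'a^'a) = (\<lambda>x. 0)" by (simp add: fun_eq_iff)
  ultimately show "op_norm A = 0" by (simp add: op_norm_def onorm_zero)
qed

text \<open>Integrability is checked in the library norm while the hypothesis bounds the operator
  norm. Each entry is at most the operator norm, and summing over all entries is crude but
  finite.\<close>

lemma norm_le_op_norm:
  fixes A :: "complex^'d^'d"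
  shows "norm A \<le> real CARD('d) * real CARD('d) * op_norm A"
proof -
  have entry: "norm (A $ i $ j) \<le> op_norm A" for i j
  proof -
    have "A $ i $ j = (A *v axis j 1) $ i"
      by (simp add: matrix_vector_mult_def axis_def if_distrib cong: if_cong)
    hence "norm (A $ i $ j) \<le> norm (A *v axis j 1)" by (metis Finite_Cartesian_Product.norm_nth_le)
    also have "\<dots> \<le> op_norm A * norm (axis j (1::complex) :: complex^'d)" by (rule op_norm_bound)
    finally show ?thesis by simp
  qed
  have "norm A \<le> (\<Sum>i\<in>UNIV. norm (A $ i))"
    unfolding norm_vec_def[of A] by (rule L2_set_le_sum) simp
  also have "\<dots> \<le> (\<Sum>i\<in>UNIV. \<Sum>j\<in>UNIV. norm (A $ i $ j))"
    unfolding norm_vec_def[of "A $ _"] by (intro sum_mono L2_set_le_sum) simp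
  also have "\<dots> \<le> (\<Sum>i\<in>(UNIV::'d set). \<Sum>j\<in>(UNIV::'d set). op_norm A)"
    by (intro sum_mono entry)
  finally show ?thesis by simp
qed

text \<open>The set is an intersection over x of sets that are closed because A x is continuous in
  A. It yields measurability of the tail event.\<close>

lemma closed_op_norm_le: "closed {A :: complex^'d^'d. op_norm A \<le> r}"
proof -
  have "{A :: complex^'d^'d. op_norm A \<le> r} = (\<Inter>x. {A. norm (A *v x) \<le> r * norm x})"
  proof (intro equalityI subsetI)
    fix A :: "complex^'d^'d" assume "A \<in> {A. op_norm A \<le> r}"
    hence "op_norm A * norm x \<le> r * norm x" for x :: "complex^'d" by (simp add: mult_right_mono)
    thus "A \<in> (\<Inter>x. {A. norm (A *v x) \<le> r * norm x})"
      using op_norm_bound[of A] order_trans by fastforce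
  next
    fix A :: "complex^'d^'d" assume "A \<in> (\<Inter>x. {A. norm (A *v x) \<le> r * norm x})"
    thus "A \<in> {A. op_norm A \<le> r}" by (auto simp: op_norm_def intro!: onorm_le)
  qed
  moreover have "closed {A :: complex^'d^'d. norm (A *v x) \<le> r * norm x}" for x
    by (intro closed_Collect_le continuous_intros linear_continuous_on bounded_linear_matrix_apply)
  ultimately show ?thesis by (simp add: closed_INT)
qed

lemma self_adjoint_symmetric_matrix:
  fixes A :: "complex^'d^'d"
  assumes "self_adjoint A"
  shows "symmetric_matrix A"
  unfolding symmetric_matrix_def
proof (intro allI)
  fix x y :: "complex^'d"
  have A: "A $ i $ j = cnj (A $ j $ i)" for i j
  proof -
    have "A $ i $ j = conj_transpose A $ i $ j" using assms by (simp add: self_adjoint_def)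
    thus ?thesis by (simp add: conj_transpose_def)
  qed
  \<comment> \<open>For the real inner product on the complex numbers, multiplication by z has
    multiplication by its conjugate as adjoint.\<close>
  have c: "(cnj z * p) \<bullet> q = p \<bullet> (z * q)" for z p q :: complex
    by (simp add: inner_complex_def algebra_simps)
  have swap: "(A $ i $ j * x $ j) \<bullet> y $ i = x $ j \<bullet> (A $ j $ i * y $ i)" for i j
    unfolding A[of i j] by (rule c)
  have "(A *v x) \<bullet> y = (\<Sum>i\<in>UNIV. \<Sum>j\<in>UNIV. (A $ i $ j * x $ j) \<bullet> y $ i)"
    by (simp add: inner_vec_def matrix_vector_mult_def inner_sum_left)
  also have "\<dots> = (\<Sum>i\<in>UNIV. \<Sum>j\<in>UNIV. x $ j \<bullet> (A $ j $ i * y $ i))"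
    by (intro sum.cong refl swap)
  also have "\<dots> = (\<Sum>j\<in>UNIV. \<Sum>i\<in>UNIV. x $ j \<bullet> (A $ j $ i * y $ i))"
    by (rule sum.swap)
  also have "\<dots> = x \<bullet> (A *v y)"
    by (simp add: inner_vec_def matrix_vector_mult_def inner_sum_right)
  finally show "(A *v x) \<bullet> y = x \<bullet> (A *v y)" .
qed

text \<open>Each coordinate carries the two real basis vectors 1 and i, and each of them contributes
  the real part of the diagonal entry.\<close>

lemma mtrace_eq_trace: "mtrace A = 2 * Re (trace A)" for A :: "complex^'d^'d"
proof -
  have "mtrace A = (\<Sum>i\<in>UNIV. \<Sum>u\<in>Basis. axis i u \<bullet> (A *v axis i u))"
    unfolding real_trace_def Basis_vec_def
    by (subst sum.UNION_disjoint) (auto simp: axis_eq_axis sum.UNION_disjoint)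
  also have "\<dots> = (\<Sum>i\<in>UNIV. \<Sum>u\<in>Basis. u \<bullet> (A $ i $ i * u))"
  proof (intro sum.cong refl)
    fix i and u :: complex
    have "(A *v axis i u) $ i = A $ i $ i * u"
      by (simp add: matrix_vector_mult_def axis_def if_distrib cong: if_cong)
    thus "axis i u \<bullet> (A *v axis i u) = u \<bullet> (A $ i $ i * u)"
      by (simp only: inner_axis')
  qed
  also have "\<dots> = 2 * Re (trace A)"
    by (simp add: Basis_complex_def trace_def inner_complex_def sum_distrib_left)
  finally show ?thesis .
qed

lemma eigenvalue_le_op_norm:
  assumes "diagonal_in ((*v) A) U a" "u \<in> U"
  shows "\<bar>a u\<bar> \<le> op_norm A"
  using op_norm_bound[of A u] diagonal_in_eigen[OF assms] by simp

lemma op_norm_le_of_eigenvalues: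
  fixes A :: "complex^'d^'d"
  assumes U: "diagonal_in ((*v) A) U a" and le: "\<And>u. u \<in> U \<Longrightarrow> \<bar>a u\<bar> \<le> t" and t: "0 \<le> t"
  shows "op_norm A \<le> t"
  unfolding op_norm_def
proof (rule onorm_le)
  fix x
  have ob: "orthonormal_basis U" using U by (simp add: diagonal_in_def)
  have sym: "(A *v y) \<bullet> z = y \<bullet> (A *v z)" for y z
    using diagonal_symmetric_matrix[OF U] by (simp add: symmetric_matrix_def)
  have "(norm (A *v x))\<^sup>2 = (\<Sum>u\<in>U. (u \<bullet> (A *v x))\<^sup>2)"
    by (rule orthonormal_basis_norm[OF ob])
  also have "\<dots> = (\<Sum>u\<in>U. (a u)\<^sup>2 * (u \<bullet> x)\<^sup>2)"
    by (intro sum.cong refl) (simp add: diagonal_in_eigen[OF U] power_mult_distrib flip: sym)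
  also have "\<dots> \<le> (\<Sum>u\<in>U. t\<^sup>2 * (u \<bullet> x)\<^sup>2)"
    using le t by (intro sum_mono mult_right_mono) (auto intro: abs_le_square_iff[THEN iffD1])
  also have "\<dots> = (t * norm x)\<^sup>2"
    unfolding power_mult_distrib orthonormal_basis_norm[OF ob] by (rule sum_distrib_left[symmetric])
  finally show "norm (A *v x) \<le> t * norm x" by (rule power2_le_imp_le) (use t in simp)
qed

lemma matrix_square_diagonal:
  fixes A :: "complex^'d^'d"
  assumes "diagonal_in ((*v) A) U a"
  shows "diagonal_in ((*v) (A ** A)) U (\<lambda>u. (a u)\<^sup>2)"
  using assms by (auto simp: diagonal_in_def power2_eq_square linear_scale[OF matrix_vector_mul_linear]
      simp flip: matrix_vector_mul_assoc)

lemma matrix_scaleR_diagonal: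
  fixes A :: "complex^'d^'d"
  assumes "diagonal_in ((*v) A) U a"
  shows "diagonal_in ((*v) (c *\<^sub>R A)) U (\<lambda>u. c * a u)"
  using assms by (auto simp: diagonal_in_def scaleR_matrix_vector)

section \<open>The Bernstein bound for a single matrix\<close>

lemma two_power_three_le_fact: "2 * 3 ^ k \<le> (fact (k + 2) :: real)"
proof (induction k)
  case (Suc k)
  have "2 * 3 ^ Suc k = 3 * (2 * 3 ^ k :: real)" by simp
  also have "\<dots> \<le> (real k + 3) * fact (k + 2)" using Suc by (intro mult_mono) auto
  also have "\<dots> = fact (Suc k + 2)" by (simp add: algebra_simps)
  finally show ?case .
qed simp

text \<open>From the quadratic term on, (k + 2)! >= 2 * 3^k bounds the exponential series by x^2 / 2
  times a geometric series of ratio u / 3. Hence the condition u < 3 and the term t U / 3 of the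
  final exponent.\<close>

lemma exp_le_bernstein:
  fixes x u :: real
  assumes "\<bar>x\<bar> \<le> u" "u < 3"
  shows "exp x \<le> 1 + x + x\<^sup>2 / (2 * (1 - u / 3))"
proof -
  have u0: "u \<ge> 0" using assms by linarith
  have "(\<lambda>k. (u / 3) ^ k) sums (1 / (1 - u / 3))"
    using assms u0 by (intro geometric_sums) simp
  from sums_mult[OF this, of "x\<^sup>2 / 2"]
  have s: "(\<lambda>k. x\<^sup>2 / 2 * (u / 3) ^ k) sums (x\<^sup>2 / (2 * (1 - u / 3)))" by simp
  have sx: "summable (\<lambda>k. inverse (fact (k + 2)) *\<^sub>R x ^ (k + 2))"
    using summable_iff_shift[of "\<lambda>k. inverse (fact k) *\<^sub>R x ^ k" 2] summable_exp_generic[of x] by simp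
  have "exp x = 1 + x + (\<Sum>k. inverse (fact (k + 2)) *\<^sub>R x ^ (k + 2))"
    by (rule exp_first_two_terms)
  also have "(\<Sum>k. inverse (fact (k + 2)) *\<^sub>R x ^ (k + 2)) \<le> (\<Sum>k. x\<^sup>2 / 2 * (u / 3) ^ k)"
  proof (rule suminf_le[OF _ sx sums_summable[OF s]])
    fix k
    have "inverse (fact (k + 2)) *\<^sub>R x ^ (k + 2) = x\<^sup>2 * x ^ k / fact (k + 2)"
      by (simp add: divide_inverse power_add power2_eq_square mult_ac del: fact_Suc)
    also have "\<dots> \<le> x\<^sup>2 * u ^ k / fact (k + 2)"
    proof -
      have "x ^ k \<le> \<bar>x\<bar> ^ k" by (metis abs_ge_self power_abs)
      also have "\<dots> \<le> u ^ k" using assms by (intro power_mono) auto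
      finally show ?thesis by (intro divide_right_mono mult_left_mono) auto
    qed
    also have "\<dots> \<le> x\<^sup>2 * u ^ k / (2 * 3 ^ k)"
      using u0 two_power_three_le_fact[of k] by (intro divide_left_mono) auto
    also have "\<dots> = x\<^sup>2 / 2 * (u / 3) ^ k" by (simp add: power_divide)
    finally show "inverse (fact (k + 2)) *\<^sub>R x ^ (k + 2) \<le> x\<^sup>2 / 2 * (u / 3) ^ k" .
  qed
  also have "\<dots> = x\<^sup>2 / (2 * (1 - u / 3))" using s by (simp add: sums_iff)
  finally show ?thesis by simp
qed

text \<open>All matrices involved are functions of \<open>X\<close>, so the scalar inequality at
  each eigenvalue suffices. The factor |r| serves both signs of r.\<close>

lemma matrix_exp_quadratic_bound:
  fixes X :: "complex^'d^'d" and r U :: real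
  assumes "symmetric_matrix X" "op_norm X \<le> U" "\<bar>r\<bar> * U < 3"
  shows "x \<bullet> (matrix_exp (r *\<^sub>R X) *v x)
     \<le> x \<bullet> x + r * (x \<bullet> (X *v x)) + r\<^sup>2 / (2 * (1 - \<bar>r\<bar> * U / 3)) * (x \<bullet> ((X ** X) *v x))"
proof -
  obtain B a where B: "diagonal_in ((*v) X) B a"
    using symmetric_matrix_eigenbasis[OF assms(1)] .
  have E: "diagonal_in ((*v) (matrix_exp (r *\<^sub>R X))) B (\<lambda>u. exp (r * a u))"
    using matrix_exp_diagonal[OF matrix_scaleR_diagonal[OF B]] by (simp add: positive_diagonal_in_def)
  have ob: "orthonormal_basis B" using B by (simp add: diagonal_in_def)
  define k where "k = 1 / (2 * (1 - \<bar>r\<bar> * U / 3))"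
  have "x \<bullet> (matrix_exp (r *\<^sub>R X) *v x) = (\<Sum>u\<in>B. exp (r * a u) * (u \<bullet> x)\<^sup>2)"
    by (simp add: diagonal_in_inner[OF E] power2_eq_square mult_ac)
  also have "\<dots> \<le> (\<Sum>u\<in>B. (1 + r * a u + r\<^sup>2 * k * (a u)\<^sup>2) * (u \<bullet> x)\<^sup>2)"
  proof (intro sum_mono mult_right_mono)
    fix u assume "u \<in> B"
    hence "\<bar>a u\<bar> \<le> U" using eigenvalue_le_op_norm[OF B] assms(2) order_trans by blast
    hence "\<bar>r * a u\<bar> \<le> \<bar>r\<bar> * U" by (simp add: abs_mult mult_left_mono)
    from exp_le_bernstein[OF this assms(3)]
    show "exp (r * a u) \<le> 1 + r * a u + r\<^sup>2 * k * (a u)\<^sup>2"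
      by (simp add: power_mult_distrib k_def)
  qed simp
  also have "\<dots> = (\<Sum>u\<in>B. (u \<bullet> x) * (u \<bullet> x)) + r * (\<Sum>u\<in>B. a u * (u \<bullet> x) * (u \<bullet> x))
      + r\<^sup>2 * k * (\<Sum>u\<in>B. (a u)\<^sup>2 * (u \<bullet> x) * (u \<bullet> x))"
    unfolding sum_distrib_left sum.distrib[symmetric]
    by (intro sum.cong refl) (simp add: power2_eq_square algebra_simps)
  also have "\<dots> = x \<bullet> x + r * (x \<bullet> (X *v x)) + r\<^sup>2 * k * (x \<bullet> ((X ** X) *v x))"
    unfolding diagonal_in_inner[OF B] diagonal_in_inner[OF matrix_square_diagonal[OF B]]
          orthonormal_basis_inner[OF ob, of x x] ..
  finally show ?thesis by (simp add: k_def)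
qed

lemma matrix_exp_ge_linear:
  assumes "symmetric_matrix V"
  shows "x \<bullet> x + x \<bullet> (V *v x) \<le> x \<bullet> (matrix_exp V *v x)"
proof -
  obtain B a where B: "diagonal_in ((*v) V) B a"
    using symmetric_matrix_eigenbasis[OF assms] .
  have E: "diagonal_in ((*v) (matrix_exp V)) B (\<lambda>u. exp (a u))"
    using matrix_exp_diagonal[OF B] by (simp add: positive_diagonal_in_def)
  have ob: "orthonormal_basis B" using B by (simp add: diagonal_in_def)
  have "x \<bullet> x + x \<bullet> (V *v x) = (\<Sum>u\<in>B. (1 + a u) * (u \<bullet> x)\<^sup>2)"
    unfolding diagonal_in_inner[OF B] orthonormal_basis_inner[OF ob, of x x]
    unfolding sum.distrib[symmetric]
    by (intro sum.cong refl) (simp add: power2_eq_square algebra_simps)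
  also have "\<dots> \<le> (\<Sum>u\<in>B. exp (a u) * (u \<bullet> x)\<^sup>2)"
    by (intro sum_mono mult_right_mono) (auto simp: exp_ge_add_one_self)
  also have "\<dots> = x \<bullet> (matrix_exp V *v x)"
    by (simp add: diagonal_in_inner[OF E] power2_eq_square mult_ac)
  finally show ?thesis .
qed

lemma mtrace_exp_pos: "symmetric_matrix A \<Longrightarrow> 0 \<le> mtrace (matrix_exp A)"
  unfolding real_trace_def by (intro sum_nonneg less_imp_le matrix_exp_positive) auto

lemma mat_expectation_eq_integral:
  assumes "integrable M X"
  shows "mat_expectation M X = integral\<^sup>L M X"
proof -
  have "bounded_linear (\<lambda>A :: complex^'d^'d. A $ i $ j)" for i j
    by (rule bounded_linear_compose[OF bounded_linear_vec_nth bounded_linear_vec_nth])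
  from integral_bounded_linear[OF this assms]
  show ?thesis by (simp add: mat_expectation_def vec_eq_iff)
qed

context prob_space
begin

lemma integrable_bounded_matrix:
  fixes X :: "'a \<Rightarrow> complex^'d^'d"
  assumes [measurable]: "X \<in> borel_measurable M" and "AE \<omega> in M. op_norm (X \<omega>) \<le> U"
  shows "AE \<omega> in M. norm (X \<omega>) \<le> real CARD('d) * real CARD('d) * U"
    and "integrable M X" and "integrable M (\<lambda>\<omega>. X \<omega> ** X \<omega>)"
proof -
  let ?C = "real CARD('d) * real CARD('d) * U"
  show bd: "AE \<omega> in M. norm (X \<omega>) \<le> ?C"
    using assms(2)
  proof eventually_elim
    case (elim \<omega>)
    show ?case using norm_le_op_norm[of "X \<omega>"] elim
      by (meson mult_left_mono mult_nonneg_nonneg of_nat_0_le_iff order_trans)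
  qed
  thus "integrable M X" by (intro integrable_const_bound) auto
  obtain K where K: "\<And>(A :: complex^'d^'d) (B :: complex^'d^'d). norm (A ** B) \<le> norm A * norm B * K" "0 < K"
    using bounded_bilinear.pos_bounded[OF bounded_bilinear_matrix_mult] by blast
  have "AE \<omega> in M. norm (X \<omega> ** X \<omega>) \<le> ?C * ?C * K"
    using bd
  proof eventually_elim
    case (elim \<omega>)
    have "norm (X \<omega>) * norm (X \<omega>) * K \<le> ?C * ?C * K"
      using elim K(2) order_trans[OF norm_ge_zero elim] by (intro mult_right_mono mult_mono) auto
    thus ?case using K(1)[of "X \<omega>" "X \<omega>"] by linarith
  qed
  thus "integrable M (\<lambda>\<omega>. X \<omega> ** X \<omega>)" by (intro integrable_const_bound) auto
qed

text \<open>In expectation the linear term of the quadratic bound vanishes, leaving 1 + V <= exp V.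
  As \<open>V\<close> depends on r only through |r|, one matrix serves r and -r.\<close>

lemma matrix_bernstein_mgf:
  fixes X :: "'a \<Rightarrow> complex^'d^'d" and r U :: real
  assumes X [measurable]: "X \<in> borel_measurable M" and b: "AE \<omega> in M. op_norm (X \<omega>) \<le> U"
    and sym: "\<And>\<omega>. \<omega> \<in> space M \<Longrightarrow> symmetric_matrix (X \<omega>)"
    and mean: "mat_expectation M X = 0" and r: "\<bar>r\<bar> * U < 3"
  defines "V \<equiv> (r\<^sup>2 / (2 * (1 - \<bar>r\<bar> * U / 3))) *\<^sub>R mat_expectation M (\<lambda>\<omega>. X \<omega> ** X \<omega>)"
  shows "symmetric_matrix V"
    and "x \<bullet> (expectation (\<lambda>\<omega>. matrix_exp (r *\<^sub>R X \<omega>)) *v x) \<le> x \<bullet> (matrix_exp V *v x)"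
proof -
  note bd = integrable_bounded_matrix[OF X b]
  let ?k = "r\<^sup>2 / (2 * (1 - \<bar>r\<bar> * U / 3))"
  have mean0: "expectation X = 0" using mean mat_expectation_eq_integral[OF bd(2)] by simp
  have V: "V = ?k *\<^sub>R expectation (\<lambda>\<omega>. X \<omega> ** X \<omega>)"
    unfolding V_def using mat_expectation_eq_integral[OF bd(3)] by simp
  show symV: "symmetric_matrix V"
    unfolding V using sym by (intro symmetric_matrix_scaleR symmetric_matrix_expectation bd symmetric_matrix_square)
  have "AE \<omega> in M. norm (r *\<^sub>R X \<omega>) \<le> \<bar>r\<bar> * (real CARD('d) * real CARD('d) * U)"
    using bd(1) by eventually_elim (simp add: mult_left_mono)
  hence int: "integrable M (\<lambda>\<omega>. matrix_exp (r *\<^sub>R X \<omega>))"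
    by (intro integrable_matrix_exp) auto
  note i1 = inner_expectation_matrix[OF bd(2), of x x] and i2 = inner_expectation_matrix[OF bd(3), of x x]
  have "x \<bullet> (expectation (\<lambda>\<omega>. matrix_exp (r *\<^sub>R X \<omega>)) *v x) = expectation (\<lambda>\<omega>. x \<bullet> (matrix_exp (r *\<^sub>R X \<omega>) *v x))"
    by (rule inner_expectation_matrix[OF int])
  also have "\<dots> \<le> expectation (\<lambda>\<omega>. x \<bullet> x + r * (x \<bullet> (X \<omega> *v x)) + ?k * (x \<bullet> ((X \<omega> ** X \<omega>) *v x)))"
  proof (rule integral_mono_AE)
    show "AE \<omega> in M. x \<bullet> (matrix_exp (r *\<^sub>R X \<omega>) *v x) \<le> x \<bullet> x + r * (x \<bullet> (X \<omega> *v x)) + ?k * (x \<bullet> ((X \<omega> ** X \<omega>) *v x))"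
      using b AE_space by eventually_elim (rule matrix_exp_quadratic_bound[OF sym _ r])
  qed (use i1(2) i2(2) inner_expectation_matrix(2)[OF int] in auto)
  also have "\<dots> = x \<bullet> x + r * (x \<bullet> (expectation X *v x)) + ?k * (x \<bullet> (expectation (\<lambda>\<omega>. X \<omega> ** X \<omega>) *v x))"
    unfolding i1(1) i2(1) using i1(2) i2(2) by (simp add: prob_space)
  also have "\<dots> = x \<bullet> x + x \<bullet> (V *v x)"
    by (simp add: mean0 V scaleR_matrix_vector)
  also have "\<dots> \<le> x \<bullet> (matrix_exp V *v x)"
    by (rule matrix_exp_ge_linear[OF symV])
  finally show "x \<bullet> (expectation (\<lambda>\<omega>. matrix_exp (r *\<^sub>R X \<omega>)) *v x) \<le> x \<bullet> (matrix_exp V *v x)" .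
qed

section \<open>Trace exponentials of sums of independent matrices\<close>

lemma indep_var_sum_matrix:
  fixes X :: "'i \<Rightarrow> 'a \<Rightarrow> complex^'d^'d"
  assumes I: "finite I" "i \<notin> I" and indep: "indep_vars (\<lambda>_. borel) X (insert i I)"
  shows "indep_var borel (\<lambda>\<omega>. \<Sum>j\<in>I. X j \<omega>) borel (X i)"
proof -
  have "indep_var
    borel ((\<lambda>f. \<Sum>j\<in>I. f j) \<circ> (\<lambda>\<omega>. restrict (\<lambda>j. X j \<omega>) I))
    borel ((\<lambda>f. f i) \<circ> (\<lambda>\<omega>. restrict (\<lambda>j. X j \<omega>) {i}))"
    using I by (intro indep_var_compose[OF indep_var_restrict[OF indep]]) auto
  also have "((\<lambda>f. f i) \<circ> (\<lambda>\<omega>. restrict (\<lambda>j. X j \<omega>) {i})) = X i"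
    by auto
  also have "((\<lambda>f. \<Sum>j\<in>I. f j) \<circ> (\<lambda>\<omega>. restrict (\<lambda>j. X j \<omega>) I)) = (\<lambda>\<omega>. \<Sum>j\<in>I. X j \<omega>)"
    by (auto cong: rev_conj_cong)
  finally show ?thesis .
qed

lemma measurable_mtrace_exp [measurable]:
  "(\<lambda>A :: complex^'d^'d. mtrace (matrix_exp A)) \<in> borel_measurable borel"
proof -
  have [measurable]: "(mtrace :: complex^'d^'d \<Rightarrow> real) \<in> borel_measurable borel"
    by (intro borel_measurable_continuous_onI linear_continuous_on bounded_linear_mtrace)
  show ?thesis by measurable
qed

text \<open>One summand at a time is replaced by its \<open>V i\<close>: with the other summands
  fixed, H + S is a constant matrix and the one-step inequality applies to the inner integral.
  Nonnegative integrals allow the iterated integration without an integrability check for the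
  sum.\<close>

lemma nn_integral_trace_exp_sum_le:
  fixes X :: "'i \<Rightarrow> 'a \<Rightarrow> complex^'d^'d" and V :: "'i \<Rightarrow> complex^'d^'d"
  assumes "finite I" and "indep_vars (\<lambda>_. borel) X I"
    and "\<And>i \<omega>. i \<in> I \<Longrightarrow> \<omega> \<in> space M \<Longrightarrow> symmetric_matrix (X i \<omega>)"
    and "\<And>i. i \<in> I \<Longrightarrow> AE \<omega> in M. norm (X i \<omega>) \<le> C"
    and "\<And>i. i \<in> I \<Longrightarrow> symmetric_matrix (V i)"
    and "\<And>i x. i \<in> I \<Longrightarrow> x \<bullet> (expectation (\<lambda>\<omega>. matrix_exp (X i \<omega>)) *v x) \<le> x \<bullet> (matrix_exp (V i) *v x)"
    and "symmetric_matrix H"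
  shows "(\<integral>\<^sup>+\<omega>. ennreal (mtrace (matrix_exp (H + (\<Sum>i\<in>I. X i \<omega>)))) \<partial>M)
    \<le> ennreal (mtrace (matrix_exp (H + (\<Sum>i\<in>I. V i))))"
  using assms
proof (induction I arbitrary: H rule: finite_induct)
  case empty
  then show ?case by (simp add: emeasure_space_1)
next
  case (insert i F)
  let ?f = "\<lambda>A :: complex^'d^'d. ennreal (mtrace (matrix_exp A))"
  let ?S = "\<lambda>\<omega>. \<Sum>j\<in>F. X j \<omega>"
  have meas [measurable]: "X j \<in> borel_measurable M" if "j \<in> insert i F" for j
    using insert.prems(1) that unfolding indep_vars_def by blast
  have Xi [measurable]: "X i \<in> borel_measurable M" by simp
  have S [measurable]: "?S \<in> borel_measurable M" by (intro borel_measurable_sum meas) auto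
  interpret Xi: prob_space "distr M borel (X i)" by (rule prob_space_distr) simp
  have "(\<integral>\<^sup>+\<omega>. ?f (H + (\<Sum>j\<in>insert i F. X j \<omega>)) \<partial>M) = (\<integral>\<^sup>+\<omega>. (case (?S \<omega>, X i \<omega>) of (s, x) \<Rightarrow> ?f (H + s + x)) \<partial>M)"
    using insert.hyps by (simp add: add_ac)
  also have "\<dots> = (\<integral>\<^sup>+p. (case p of (s, x) \<Rightarrow> ?f (H + s + x)) \<partial>distr M (borel \<Otimes>\<^sub>M borel) (\<lambda>\<omega>. (?S \<omega>, X i \<omega>)))"
    by (rule nn_integral_distr[symmetric]) measurable
  \<comment> \<open>Independence enters here: the joint law of the partial sum and the new summand
    is a product.\<close>
  also have "distr M (borel \<Otimes>\<^sub>M borel) (\<lambda>\<omega>. (?S \<omega>, X i \<omega>)) = distr M borel ?S \<Otimes>\<^sub>M distr M borel (X i)"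
    using indep_var_sum_matrix[OF insert.hyps insert.prems(1)] by (simp add: indep_var_distribution_eq)
  also have "(\<integral>\<^sup>+p. (case p of (s, x) \<Rightarrow> ?f (H + s + x)) \<partial>(distr M borel ?S \<Otimes>\<^sub>M distr M borel (X i)))
      = (\<integral>\<^sup>+s. (\<integral>\<^sup>+x. ?f (H + s + x) \<partial>distr M borel (X i)) \<partial>distr M borel ?S)"
    by (subst Xi.nn_integral_fst[symmetric]) simp_all
  also have "\<dots> = (\<integral>\<^sup>+\<omega>. (\<integral>\<^sup>+x. ?f (H + ?S \<omega> + x) \<partial>distr M borel (X i)) \<partial>M)"
    by (rule nn_integral_distr) measurable
  also have "\<dots> \<le> (\<integral>\<^sup>+\<omega>. ?f ((H + V i) + ?S \<omega>) \<partial>M)"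
  proof (rule nn_integral_mono)
    fix \<omega> assume w: "\<omega> \<in> space M"
    have sym: "symmetric_matrix (H + ?S \<omega>)"
      using insert.prems(2,6) w by (intro symmetric_matrix_add symmetric_matrix_sum) auto
    have i: "i \<in> insert i F" by simp
    note step = expectation_trace_exp_le[OF sym insert.prems(4)[OF i] Xi insert.prems(3)[OF i]
        insert.prems(2)[OF i] insert.prems(5)[OF i]]
    have "(\<integral>\<^sup>+x. ?f (H + ?S \<omega> + x) \<partial>distr M borel (X i)) = (\<integral>\<^sup>+\<omega>'. ?f (H + ?S \<omega> + X i \<omega>') \<partial>M)"
      by (rule nn_integral_distr) measurable
    also have "\<dots> = ennreal (expectation (\<lambda>\<omega>'. mtrace (matrix_exp (H + ?S \<omega> + X i \<omega>'))))"
      by (intro nn_integral_eq_integral step(2) AE_I2 mtrace_exp_pos symmetric_matrix_add[OF sym] insert.prems(2)[OF i])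
    also have "\<dots> \<le> ennreal (mtrace (matrix_exp (H + ?S \<omega> + V i)))"
      by (intro ennreal_leI step(1))
    finally show "(\<integral>\<^sup>+x. ?f (H + ?S \<omega> + x) \<partial>distr M borel (X i)) \<le> ?f ((H + V i) + ?S \<omega>)"
      by (simp add: add_ac)
  qed
  \<comment> \<open>The bound \<open>V i\<close> is absorbed into the constant matrix, which is why
    \<open>H\<close> is arbitrary in the induction.\<close>
  also have "\<dots> \<le> ?f ((H + V i) + (\<Sum>j\<in>F. V j))"
  proof (rule insert.IH)
    show "indep_vars (\<lambda>_. borel) X F"
      by (rule indep_vars_subset[OF insert.prems(1)]) auto
    show "symmetric_matrix (H + V i)"
      using insert.prems(4,6) by (intro symmetric_matrix_add) auto
  qed (use insert.prems(2-5) in auto)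
  finally show ?case using insert.hyps by (simp add: add_ac)
qed

end

section \<open>The tail bound\<close>

text \<open>In an eigenbasis of \<open>S\<close>, \<phi> is the sum of 2 cosh (r a) - 2 over the
  eigenvalues a. No term is negative, so one eigenvalue with |a| > t gives the second bound,
  whatever its sign.\<close>

lemma cosh_trace_nonneg:
  fixes S :: "complex^'d^'d"
  assumes "symmetric_matrix S" and t: "0 \<le> t" and r: "0 < r"
  defines "\<phi> \<equiv> mtrace (matrix_exp (r *\<^sub>R S)) + mtrace (matrix_exp ((- r) *\<^sub>R S)) - 2 * mtrace (mat 1 :: complex^'d^'d)"
  shows "0 \<le> \<phi>" and "t < op_norm S \<Longrightarrow> 2 * cosh (r * t) - 2 \<le> \<phi>"
proof -
  obtain B a where B: "diagonal_in ((*v) S) B a"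
    using symmetric_matrix_eigenbasis[OF assms(1)] .
  have fin: "finite B" and ob: "orthonormal_basis B"
    using B orthonormal_basis_finite by (auto simp: diagonal_in_def)
  have E: "mtrace (matrix_exp (c *\<^sub>R S)) = (\<Sum>u\<in>B. exp (c * a u))" for c
    using matrix_exp_diagonal[OF matrix_scaleR_diagonal[OF B]]
    by (intro real_trace_diagonal) (simp add: positive_diagonal_in_def)
  have "diagonal_in ((*v) (mat 1 :: complex^'d^'d)) B (\<lambda>_. 1)"
    using ob by (simp add: diagonal_in_def)
  from real_trace_diagonal[OF this]
  have one: "mtrace (mat 1 :: complex^'d^'d) = (\<Sum>u\<in>B. 1)" .
  have cosh: "2 * cosh x - 2 = exp x + exp (- x) - 2 * 1" for x :: real
    by (simp add: cosh_field_def field_simps)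
  have phi: "\<phi> = (\<Sum>u\<in>B. 2 * cosh (r * a u) - 2)"
    unfolding \<phi>_def E one cosh sum.distrib sum_subtractf sum_distrib_left by simp
  have nn: "0 \<le> 2 * cosh x - 2" for x :: real using cosh_real_ge_1[of x] by simp
  show "0 \<le> \<phi>" unfolding phi by (intro sum_nonneg nn)
  assume "t < op_norm S"
  then obtain u where u: "u \<in> B" "t < \<bar>a u\<bar>"
    using op_norm_le_of_eigenvalues[OF B _ t] by (meson not_le)
  have "cosh (r * t) \<le> cosh (r * \<bar>a u\<bar>)"
    using u(2) t r by (subst cosh_real_nonneg_le_iff) auto
  also have "\<dots> = cosh (r * a u)" by (simp add: abs_if)
  finally have "2 * cosh (r * t) - 2 \<le> 2 * cosh (r * a u) - 2" by simp
  also have "\<dots> \<le> \<phi>" unfolding phi by (rule member_le_sum[OF u(1) nn fin])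
  finally show "2 * cosh (r * t) - 2 \<le> \<phi>" .
qed

context prob_space
begin

lemma matrix_bernstein_laplace:
  fixes X :: "'i \<Rightarrow> 'a \<Rightarrow> complex^'d^'d" and r U :: real
  assumes fin: "finite I" and indep: "indep_vars (\<lambda>_. borel) X I"
    and sym: "\<And>i \<omega>. i \<in> I \<Longrightarrow> \<omega> \<in> space M \<Longrightarrow> symmetric_matrix (X i \<omega>)"
    and mean: "\<And>i. i \<in> I \<Longrightarrow> mat_expectation M (X i) = 0"
    and b: "\<And>i. i \<in> I \<Longrightarrow> AE \<omega> in M. op_norm (X i \<omega>) \<le> U"
    and r: "\<bar>r\<bar> * U < 3"
  defines "V \<equiv> \<Sum>i\<in>I. mat_expectation M (\<lambda>\<omega>. X i \<omega> ** X i \<omega>)"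
  shows "integrable M (\<lambda>\<omega>. mtrace (matrix_exp (r *\<^sub>R (\<Sum>i\<in>I. X i \<omega>))))"
    and "expectation (\<lambda>\<omega>. mtrace (matrix_exp (r *\<^sub>R (\<Sum>i\<in>I. X i \<omega>))))
      \<le> mtrace (matrix_exp ((r\<^sup>2 / (2 * (1 - \<bar>r\<bar> * U / 3))) *\<^sub>R V))"
proof -
  let ?C = "\<bar>r\<bar> * (real CARD('d) * real CARD('d) * U)"
  let ?k = "r\<^sup>2 / (2 * (1 - \<bar>r\<bar> * U / 3))"
  let ?V = "\<lambda>i. ?k *\<^sub>R mat_expectation M (\<lambda>\<omega>. X i \<omega> ** X i \<omega>)"
  have meas: "X i \<in> borel_measurable M" if "i \<in> I" for i
    using indep that unfolding indep_vars_def by blast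
  have S [measurable]: "(\<lambda>\<omega>. \<Sum>i\<in>I. X i \<omega>) \<in> borel_measurable M"
    by (intro borel_measurable_sum meas)
  have bd: "AE \<omega> in M. norm (r *\<^sub>R X i \<omega>) \<le> ?C" if "i \<in> I" for i
    using integrable_bounded_matrix(1)[OF meas[OF that] b[OF that]]
    by eventually_elim (simp add: mult_left_mono)
  have "AE \<omega> in M. \<forall>i\<in>I. norm (r *\<^sub>R X i \<omega>) \<le> ?C"
    using bd fin by (intro AE_finite_allI) auto
  hence "AE \<omega> in M. norm (r *\<^sub>R (\<Sum>i\<in>I. X i \<omega>)) \<le> real (card I) * ?C"
  proof eventually_elim
    case (elim \<omega>)
    thus ?case unfolding scaleR_right.sum by (intro sum_norm_bound) auto
  qed
  hence "integrable M (\<lambda>\<omega>. matrix_exp (r *\<^sub>R (\<Sum>i\<in>I. X i \<omega>)))"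
    by (intro integrable_matrix_exp) auto
  from integrable_bounded_linear[OF bounded_linear_mtrace this]
  show int: "integrable M (\<lambda>\<omega>. mtrace (matrix_exp (r *\<^sub>R (\<Sum>i\<in>I. X i \<omega>))))" .
  have "indep_vars (\<lambda>_. borel) (\<lambda>i \<omega>. r *\<^sub>R X i \<omega>) I"
    by (rule indep_vars_compose2[OF indep]) measurable
  from nn_integral_trace_exp_sum_le[OF fin this, where H=0 and C="?C" and V="?V"]
  have "(\<integral>\<^sup>+\<omega>. ennreal (mtrace (matrix_exp (\<Sum>i\<in>I. r *\<^sub>R X i \<omega>))) \<partial>M)
      \<le> ennreal (mtrace (matrix_exp (\<Sum>i\<in>I. ?V i)))"
    using matrix_bernstein_mgf[OF meas b sym mean r] bd sym
    by (simp add: symmetric_matrix_zero symmetric_matrix_scaleR)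
  hence "(\<integral>\<^sup>+\<omega>. ennreal (mtrace (matrix_exp (r *\<^sub>R (\<Sum>i\<in>I. X i \<omega>)))) \<partial>M)
      \<le> ennreal (mtrace (matrix_exp (?k *\<^sub>R V)))"
    by (simp add: V_def scaleR_right.sum)
  moreover have "(\<integral>\<^sup>+\<omega>. ennreal (mtrace (matrix_exp (r *\<^sub>R (\<Sum>i\<in>I. X i \<omega>)))) \<partial>M)
      = ennreal (expectation (\<lambda>\<omega>. mtrace (matrix_exp (r *\<^sub>R (\<Sum>i\<in>I. X i \<omega>)))))"
    using sym by (intro nn_integral_eq_integral int AE_I2 mtrace_exp_pos symmetric_matrix_scaleR symmetric_matrix_sum) auto
  moreover have "symmetric_matrix (?k *\<^sub>R V)"
    unfolding V_def scaleR_right.sum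
    using matrix_bernstein_mgf(1)[OF meas b sym mean r] by (intro symmetric_matrix_sum)
  ultimately show "expectation (\<lambda>\<omega>. mtrace (matrix_exp (r *\<^sub>R (\<Sum>i\<in>I. X i \<omega>))))
      \<le> mtrace (matrix_exp (?k *\<^sub>R V))"
    by (simp add: ennreal_le_iff mtrace_exp_pos)
qed

text \<open>Markov's inequality for the nonnegative even function of
  \<open>cosh_trace_nonneg\<close>. The Laplace bounds at r and -r coincide, hence the factor 2 on
  the right.\<close>

lemma matrix_bernstein_tail:
  fixes X :: "'i \<Rightarrow> 'a \<Rightarrow> complex^'d^'d" and r U t :: real
  assumes fin: "finite I" and indep: "indep_vars (\<lambda>_. borel) X I"
    and sym: "\<And>i \<omega>. i \<in> I \<Longrightarrow> \<omega> \<in> space M \<Longrightarrow> symmetric_matrix (X i \<omega>)"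
    and mean: "\<And>i. i \<in> I \<Longrightarrow> mat_expectation M (X i) = 0"
    and b: "\<And>i. i \<in> I \<Longrightarrow> AE \<omega> in M. op_norm (X i \<omega>) \<le> U"
    and r: "0 < r" "r * U < 3" and t: "0 \<le> t"
  defines "V \<equiv> \<Sum>i\<in>I. mat_expectation M (\<lambda>\<omega>. X i \<omega> ** X i \<omega>)"
  shows "(2 * cosh (r * t) - 2) * prob {\<omega> \<in> space M. t < op_norm (\<Sum>i\<in>I. X i \<omega>)}
    \<le> 2 * (mtrace (matrix_exp ((r\<^sup>2 / (2 * (1 - r * U / 3))) *\<^sub>R V)) - mtrace (mat 1 :: complex^'d^'d))"
proof -
  let ?S = "\<lambda>\<omega>. \<Sum>i\<in>I. X i \<omega>"
  let ?A = "{\<omega> \<in> space M. t < op_norm (?S \<omega>)}"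
  let ?I = "mtrace (mat 1 :: complex^'d^'d)"
  let ?phi = "\<lambda>\<omega>. mtrace (matrix_exp (r *\<^sub>R ?S \<omega>)) + mtrace (matrix_exp ((- r) *\<^sub>R ?S \<omega>)) - 2 * ?I"
  have symS: "symmetric_matrix (?S \<omega>)" if "\<omega> \<in> space M" for \<omega>
    using sym that by (intro symmetric_matrix_sum)
  have meas: "X i \<in> borel_measurable M" if "i \<in> I" for i
    using indep that unfolding indep_vars_def by blast
  have S [measurable]: "?S \<in> borel_measurable M"
    by (intro borel_measurable_sum meas)
  have "{A :: complex^'d^'d. op_norm A \<le> t} \<in> sets borel"
    by (intro borel_closed closed_op_norm_le)
  \<comment> \<open>The tail event is the complement of the preimage of a closed set.\<close>
  hence "space M - ?S -` {A. op_norm A \<le> t} \<inter> space M \<in> events"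
    by (intro sets.Diff measurable_sets[OF S]) auto
  also have "space M - ?S -` {A. op_norm A \<le> t} \<inter> space M = ?A" by auto
  finally have A: "?A \<in> events" .
  have r1: "\<bar>r\<bar> * U < 3" "\<bar>- r\<bar> * U < 3" using r by auto
  note L1 = matrix_bernstein_laplace[OF fin indep sym mean b r1(1)]
  note L2 = matrix_bernstein_laplace[OF fin indep sym mean b r1(2)]
  have "(2 * cosh (r * t) - 2) * prob ?A = expectation (\<lambda>\<omega>. (2 * cosh (r * t) - 2) * indicator ?A \<omega>)"
    using A by simp
  also have "\<dots> \<le> expectation ?phi"
  proof (rule integral_mono)
    show "integrable M (\<lambda>\<omega>. (2 * cosh (r * t) - 2) * indicator ?A \<omega>)"
      using A by (intro integrable_mult_right integrable_real_indicator) (auto simp: emeasure_eq_measure)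
    show "integrable M ?phi" using L1(1) L2(1) by auto
    show "(2 * cosh (r * t) - 2) * indicator ?A \<omega> \<le> ?phi \<omega>" if "\<omega> \<in> space M" for \<omega>
      using cosh_trace_nonneg[OF symS[OF that] t r(1)] by (auto simp: indicator_def)
  qed
  also have "\<dots> = expectation (\<lambda>\<omega>. mtrace (matrix_exp (r *\<^sub>R ?S \<omega>)))
      + expectation (\<lambda>\<omega>. mtrace (matrix_exp ((- r) *\<^sub>R ?S \<omega>))) - 2 * ?I"
    using L1(1) L2(1) by (simp add: prob_space)
  also have "\<dots> \<le> 2 * (mtrace (matrix_exp ((r\<^sup>2 / (2 * (1 - r * U / 3))) *\<^sub>R V)) - ?I)"
    using L1(2) L2(2) r(1) by (simp add: V_def)
  finally show ?thesis .
qed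

text \<open>Pointwise x . X^2 x = |X x|^2 by symmetry, and expectation and sum preserve the
  sign.\<close>

lemma variance_matrix_nonneg:
  fixes X :: "'i \<Rightarrow> 'a \<Rightarrow> complex^'d^'d"
  assumes meas: "\<And>i. i \<in> I \<Longrightarrow> X i \<in> borel_measurable M"
    and sym: "\<And>i \<omega>. i \<in> I \<Longrightarrow> \<omega> \<in> space M \<Longrightarrow> symmetric_matrix (X i \<omega>)"
    and b: "\<And>i. i \<in> I \<Longrightarrow> AE \<omega> in M. op_norm (X i \<omega>) \<le> U"
  defines "V \<equiv> \<Sum>i\<in>I. mat_expectation M (\<lambda>\<omega>. X i \<omega> ** X i \<omega>)"
  shows "symmetric_matrix V" and "0 \<le> x \<bullet> (V *v x)"
proof -
  have E: "mat_expectation M (\<lambda>\<omega>. X i \<omega> ** X i \<omega>) = expectation (\<lambda>\<omega>. X i \<omega> ** X i \<omega>)" if "i \<in> I" for i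
    by (rule mat_expectation_eq_integral[OF integrable_bounded_matrix(3)[OF meas[OF that] b[OF that]]])
  show "symmetric_matrix V"
    unfolding V_def
  proof (rule symmetric_matrix_sum)
    fix i assume i: "i \<in> I"
    show "symmetric_matrix (mat_expectation M (\<lambda>\<omega>. X i \<omega> ** X i \<omega>))"
      unfolding E[OF i] using integrable_bounded_matrix(3)[OF meas[OF i] b[OF i]] sym[OF i]
      by (intro symmetric_matrix_expectation symmetric_matrix_square)
  qed
  have "x \<bullet> (V *v x) = (\<Sum>i\<in>I. x \<bullet> (mat_expectation M (\<lambda>\<omega>. X i \<omega> ** X i \<omega>) *v x))"
    unfolding V_def by (simp add: linear_sum[OF linear_matrix_apply] inner_sum_right)
  also have "\<dots> \<ge> 0"
  proof (rule sum_nonneg)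
    fix i assume i: "i \<in> I"
    have "0 \<le> expectation (\<lambda>\<omega>. x \<bullet> ((X i \<omega> ** X i \<omega>) *v x))"
    proof (rule Bochner_Integration.integral_nonneg)
      fix \<omega> assume "\<omega> \<in> space M"
      hence "x \<bullet> ((X i \<omega> ** X i \<omega>) *v x) = (X i \<omega> *v x) \<bullet> (X i \<omega> *v x)"
        using sym[OF i] by (simp add: symmetric_matrix_def flip: matrix_vector_mul_assoc)
      thus "0 \<le> x \<bullet> ((X i \<omega> ** X i \<omega>) *v x)" by simp
    qed
    thus "0 \<le> x \<bullet> (mat_expectation M (\<lambda>\<omega>. X i \<omega> ** X i \<omega>) *v x)"
      unfolding E[OF i] by (simp add: inner_expectation_matrix[OF integrable_bounded_matrix(3)[OF meas[OF i] b[OF i]]])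
  qed
  finally show "0 \<le> x \<bullet> (V *v x)" .
qed

end

section \<open>Effective rank, scalar estimates and the choice of r\<close>

lemma exp_minus_one_chord:
  fixes v s c :: real
  assumes "0 \<le> v" "v \<le> s" "0 < s"
  shows "exp (c * v) - 1 \<le> v / s * (exp (c * s) - 1)"
proof -
  from convex_onD[OF exp_convex, of "v / s" 0 "c * s"]
  have "exp (v / s * (c * s)) \<le> (1 - v / s) * exp 0 + v / s * exp (c * s)"
    using assms by simp
  thus ?thesis using assms by (simp add: algebra_simps)
qed

text \<open>The factor 2 relates the real trace on \<open>complex^'d\<close>, of real dimension \<open>2d\<close>, to the complex one.\<close>

lemma trace_exp_le_effective_rank:
  fixes V :: "complex^'d^'d"
  assumes sym: "symmetric_matrix V" and pos: "\<And>x. 0 \<le> x \<bullet> (V *v x)" and c: "0 \<le> c" and s: "op_norm V \<le> s"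
  shows "mtrace (matrix_exp (c *\<^sub>R V)) - mtrace (mat 1 :: complex^'d^'d)
     \<le> 2 * effective_rank V * (exp (c * s) - 1)"
    and "0 \<le> effective_rank V"
proof -
  obtain B v where B: "diagonal_in ((*v) V) B v"
    using symmetric_matrix_eigenbasis[OF sym] .
  have ob: "orthonormal_basis B" using B by (simp add: diagonal_in_def)
  have v0: "0 \<le> v u" if "u \<in> B" for u
    using pos[of u] diagonal_in_eigen[OF B that] by simp
  have trV: "mtrace V = (\<Sum>u\<in>B. v u)" by (rule real_trace_diagonal[OF B])
  have "0 \<le> mtrace V" unfolding trV by (rule sum_nonneg[OF v0])
  thus er: "0 \<le> effective_rank V"
    by (simp add: effective_rank_def mtrace_eq_trace op_norm_nonneg)
  have E: "mtrace (matrix_exp (c *\<^sub>R V)) = (\<Sum>u\<in>B. exp (c * v u))"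
    using matrix_exp_diagonal[OF matrix_scaleR_diagonal[OF B]]
    by (intro real_trace_diagonal) (simp add: positive_diagonal_in_def)
  have "diagonal_in ((*v) (mat 1 :: complex^'d^'d)) B (\<lambda>_. 1)"
    using ob by (simp add: diagonal_in_def)
  from real_trace_diagonal[OF this]
  have diff: "mtrace (matrix_exp (c *\<^sub>R V)) - mtrace (mat 1 :: complex^'d^'d) = (\<Sum>u\<in>B. exp (c * v u) - 1)"
    by (simp add: E sum_subtractf)
  show "mtrace (matrix_exp (c *\<^sub>R V)) - mtrace (mat 1 :: complex^'d^'d)
     \<le> 2 * effective_rank V * (exp (c * s) - 1)"
  proof (cases "V = 0")
    case True
    \<comment> \<open>The convention r(0) = 0 makes the right side 0; all eigenvalues vanish, so the
      left side is 0 as well.\<close>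
    have "v u = 0" if "u \<in> B" for u
      using eigenvalue_le_op_norm[OF B that] op_norm_eq_0[of V] True by simp
    thus ?thesis unfolding diff by (simp add: True effective_rank_def)
  next
    case False
    hence p: "op_norm V > 0" using op_norm_nonneg[of V] op_norm_eq_0[of V] by linarith
    \<comment> \<open>The chord from 0 to the largest possible eigenvalue \<open>op_norm V\<close>
      bounds each term by a multiple of v u, so the sum sees the trace and not the
      dimension.\<close>
    have "(\<Sum>u\<in>B. exp (c * v u) - 1) \<le> (\<Sum>u\<in>B. v u / op_norm V * (exp (c * op_norm V) - 1))"
      using v0 eigenvalue_le_op_norm[OF B] p by (intro sum_mono exp_minus_one_chord) force+
    also have "\<dots> = mtrace V / op_norm V * (exp (c * op_norm V) - 1)"
      by (simp add: trV sum_divide_distrib sum_distrib_right)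
    also have "\<dots> = 2 * effective_rank V * (exp (c * op_norm V) - 1)"
      using False by (simp add: effective_rank_def mtrace_eq_trace)
    also have "\<dots> \<le> 2 * effective_rank V * (exp (c * s) - 1)"
      using er c s by (intro mult_left_mono) (auto intro: mult_left_mono)
    finally show ?thesis unfolding diff .
  qed
qed

text \<open>The source of 14. For a >= 1, y = exp a is at least 1 + 1 + 1/2, and with 2 cosh a = y +
  1 / y the claim becomes 10 y^2 - 28 y + 14 >= 0, which holds for y >= 5/2. The 4 is the factor in
  front of the effective rank in the tail bound.\<close>

lemma exp_le_cosh:
  fixes a :: real
  assumes "1 \<le> a"
  shows "4 * exp a \<le> 14 * (2 * cosh a - 2)" and "0 < 2 * cosh a - 2"
proof -
  define y where "y = exp a"
  have y: "y > 0" by (simp add: y_def)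
  have "1 + a + a\<^sup>2 / 2 \<le> y" unfolding y_def using assms by (intro exp_lower_Taylor_quadratic) simp
  moreover have "1 \<le> a\<^sup>2" using assms by (simp add: one_le_power)
  ultimately have y25: "y \<ge> 5 / 2" using assms by linarith
  have c: "2 * cosh a = y + 1 / y"
    by (simp add: cosh_field_def y_def exp_minus inverse_eq_divide)
  have "0 \<le> (y - 5 / 2) * (10 * y - 3) + 13 / 2" using y25 by (intro add_nonneg_nonneg mult_nonneg_nonneg) auto
  also have "\<dots> = 10 * y\<^sup>2 - 28 * y + 14" by (simp add: power2_eq_square algebra_simps)
  finally have "0 \<le> (10 * y\<^sup>2 - 28 * y + 14) / y" using y by simp
  also have "\<dots> = 14 * (2 * cosh a - 2) - 4 * y"
    using y unfolding c by (simp add: field_simps power2_eq_square)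
  finally show le: "4 * exp a \<le> 14 * (2 * cosh a - 2)" by (simp add: y_def)
  have "0 < 4 * exp a" by simp
  from less_le_trans[OF this le] show "0 < 2 * cosh a - 2" by simp
qed

text \<open>With D = \<sigma>^2 + t U / 3 and r = t / D one gets 1 - r U / 3 = \<sigma>^2 / D, so
  the Laplace exponent collapses to r t / 2, half of the r t gained from cosh. The lower bound on t
  is the positive root of t^2 = D, so it gives D <= t^2, that is r t >= 1.\<close>

lemma bernstein_exponent:
  fixes \<sigma> U t :: real
  assumes U: "U > 0" and \<sigma>: "\<sigma> > 0" and t: "t \<ge> 1 / 6 * (U + sqrt (U\<^sup>2 + 36 * \<sigma>\<^sup>2))"
  defines "r \<equiv> t / (\<sigma>\<^sup>2 + t * U / 3)"
  shows "0 < r" "r * U < 3" "1 \<le> r * t"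
    and "r\<^sup>2 / (2 * (1 - r * U / 3)) * \<sigma>\<^sup>2 = r * t / 2"
    and "(t\<^sup>2 / 2) / (\<sigma>\<^sup>2 + t * U / 3) = r * t / 2"
proof -
  have "0 < 1 / 6 * (U + sqrt (U\<^sup>2 + 36 * \<sigma>\<^sup>2))"
    using U by (intro mult_pos_pos add_pos_nonneg) auto
  hence t0: "t > 0" using t by (rule less_le_trans)
  define D where "D = \<sigma>\<^sup>2 + t * U / 3"
  have s2: "\<sigma>\<^sup>2 > 0" using \<sigma> by simp
  have D: "D > 0" using s2 t0 U by (simp add: D_def add_pos_pos)
  have r: "r = t / D" by (simp add: r_def D_def)
  show "0 < r" using t0 D by (simp add: r)
  have "\<sigma>\<^sup>2 / D = (D - t * U / 3) / D" by (simp add: D_def)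
  also have "\<dots> = 1 - r * U / 3" using D by (simp add: r diff_divide_distrib)
  finally have one: "1 - r * U / 3 = \<sigma>\<^sup>2 / D" ..
  moreover have "\<sigma>\<^sup>2 / D > 0" using s2 D by simp
  ultimately show "r * U < 3" by linarith
  show "r\<^sup>2 / (2 * (1 - r * U / 3)) * \<sigma>\<^sup>2 = r * t / 2"
    unfolding one using \<sigma> D by (simp add: r power2_eq_square)
  show "(t\<^sup>2 / 2) / (\<sigma>\<^sup>2 + t * U / 3) = r * t / 2"
    by (simp add: r_def power2_eq_square)
  have "sqrt (U\<^sup>2 + 36 * \<sigma>\<^sup>2) \<le> 6 * t - U" using t by simp
  hence "U\<^sup>2 + 36 * \<sigma>\<^sup>2 \<le> (6 * t - U)\<^sup>2" by (rule sqrt_le_D)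
  hence "D \<le> t * t" by (simp add: D_def power2_eq_square algebra_simps)
  thus "1 \<le> r * t" using D by (simp add: r)
qed

theorem theorem3p1:
  fixes M :: "'w measure"
    and X :: "nat \<Rightarrow> 'w \<Rightarrow> complex^'d^'d"
    and n :: nat
    and \<sigma> U t :: real
  assumes "prob_space M"
    and "prob_space.indep_vars M (\<lambda>_. borel) X {1..n}"
    and "\<And>i \<omega>. i \<in> {1..n} \<Longrightarrow> \<omega> \<in> space M \<Longrightarrow> self_adjoint (X i \<omega>)"
    and "\<And>i. i \<in> {1..n} \<Longrightarrow> mat_expectation M (X i) = 0"
    and "\<sigma> \<ge> 0"
    and "\<sigma>\<^sup>2 \<ge> op_norm (\<Sum>i = 1..n. mat_expectation M (\<lambda>\<omega>. X i \<omega> ** X i \<omega>))"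
    and "U > 0"
    and "\<And>i. i \<in> {1..n} \<Longrightarrow> AE \<omega> in M. op_norm (X i \<omega>) \<le> U"
    and "t \<ge> 1 / 6 * (U + sqrt (U\<^sup>2 + 36 * \<sigma>\<^sup>2))"
  shows "measure M {\<omega> \<in> space M. op_norm (\<Sum>i = 1..n. X i \<omega>) > t}
    \<le> 14 * effective_rank (\<Sum>i = 1..n. mat_expectation M (\<lambda>\<omega>. X i \<omega> ** X i \<omega>))
        * exp (- ((t\<^sup>2 / 2) / (\<sigma>\<^sup>2 + t * U / 3)))"
proof -
  interpret prob_space M by fact
  let ?V = "\<Sum>i = 1..n. mat_expectation M (\<lambda>\<omega>. X i \<omega> ** X i \<omega>)"
  let ?P = "prob {\<omega> \<in> space M. op_norm (\<Sum>i = 1..n. X i \<omega>) > t}"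
  have sym: "symmetric_matrix (X i \<omega>)" if "i \<in> {1..n}" "\<omega> \<in> space M" for i \<omega>
    using assms(3)[OF that] by (rule self_adjoint_symmetric_matrix)
  have meas: "X i \<in> borel_measurable M" if "i \<in> {1..n}" for i
    using assms(2) that unfolding indep_vars_def by blast
  have V1: "symmetric_matrix ?V"
    using meas sym assms(8) by (rule variance_matrix_nonneg(1))
  have V2: "0 \<le> x \<bullet> (?V *v x)" for x
    using meas sym assms(8) by (rule variance_matrix_nonneg(2))
  note V = V1 V2
  have "0 < 1 / 6 * (U + sqrt (U\<^sup>2 + 36 * \<sigma>\<^sup>2))"
    using assms(7) by (intro mult_pos_pos add_pos_nonneg) auto
  hence t0: "t > 0" using assms(9) by (rule less_le_trans)
  \<comment> \<open>The 4 is 2 for the signs r and -r times 2 for real against complex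
    traces.\<close>
  have tail: "(2 * cosh (r * t) - 2) * ?P
      \<le> 4 * effective_rank ?V * (exp (r\<^sup>2 / (2 * (1 - r * U / 3)) * \<sigma>\<^sup>2) - 1)"
    if r: "0 < r" "r * U < 3" for r
  proof -
    have k: "0 \<le> r\<^sup>2 / (2 * (1 - r * U / 3))"
      using r(2) by (intro divide_nonneg_nonneg) (simp_all add: mult.commute)
    have "(2 * cosh (r * t) - 2) * ?P
        \<le> 2 * (mtrace (matrix_exp ((r\<^sup>2 / (2 * (1 - r * U / 3))) *\<^sub>R ?V)) - mtrace (mat 1 :: complex^'d^'d))"
      using t0 by (intro matrix_bernstein_tail[OF _ assms(2) sym assms(4,8) r]) auto
    also have "\<dots> \<le> 2 * (2 * effective_rank ?V * (exp (r\<^sup>2 / (2 * (1 - r * U / 3)) * \<sigma>\<^sup>2) - 1))"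
      using trace_exp_le_effective_rank(1)[OF V k assms(6)] by - (rule mult_left_mono, assumption, simp)
    finally show ?thesis by simp
  qed
  have er: "0 \<le> effective_rank ?V"
    \<comment> \<open>The instance with c = 0 and s equal to the norm itself.\<close>
    by (rule trace_exp_le_effective_rank(2)[OF V order_refl order_refl])
  show ?thesis
  proof (cases "\<sigma> = 0")
    case True
    \<comment> \<open>Here the variance is 0, so any admissible r makes the right side of
      \<open>tail\<close> zero; r = 1 / U is one, and the positive cosh factor forces probability
      0.\<close>
    have "0 < 2 * cosh (1 / U * t) - 2"
      using cosh_real_nonneg_less_iff[of 0 "1 / U * t"] t0 assms(7) by simp
    moreover have "(2 * cosh (1 / U * t) - 2) * ?P \<le> 0"
      using tail[of "1 / U"] True assms(7) by simp
    ultimately have "?P \<le> 0" by (simp add: mult_le_0_iff not_less)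
    also have "0 \<le> 14 * effective_rank ?V * exp (- ((t\<^sup>2 / 2) / (\<sigma>\<^sup>2 + t * U / 3)))"
      using er by simp
    finally show ?thesis .
  next
    case False
    hence \<sigma>: "\<sigma> > 0" using assms(5) by simp
    define r where "r = t / (\<sigma>\<^sup>2 + t * U / 3)"
    note r = bernstein_exponent[OF assms(7) \<sigma> assms(9), folded r_def]
    note c = exp_le_cosh[OF r(3)]
    let ?q = "2 * cosh (r * t) - 2"
    have "?q * ?P \<le> 4 * effective_rank ?V * (exp (r * t / 2) - 1)"
      using tail[OF r(1,2)] unfolding r(4) .
    \<comment> \<open>The -1 is dropped and exp (r t / 2) is split as exp (r t) exp (-r t / 2), so
      that the first factor can be traded for the cosh factor on the left.\<close>
    also have "\<dots> \<le> effective_rank ?V * (4 * exp (r * t)) * exp (- (r * t / 2))"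
    proof -
      have e: "exp (r * t) * exp (- (r * t / 2)) = exp (r * t / 2)"
        by (simp flip: exp_add)
      have "effective_rank ?V * (4 * exp (r * t)) * exp (- (r * t / 2))
          = 4 * effective_rank ?V * exp (r * t / 2)"
        unfolding e[symmetric] by (simp only: mult_ac)
      moreover have "4 * effective_rank ?V * (exp (r * t / 2) - 1) \<le> 4 * effective_rank ?V * exp (r * t / 2)"
        using er by (intro mult_left_mono) auto
      ultimately show ?thesis by (simp only:)
    qed
    also have "\<dots> \<le> effective_rank ?V * (14 * ?q) * exp (- (r * t / 2))"
      using er c(1) by (intro mult_right_mono mult_left_mono) auto
    also have "\<dots> = ?q * (14 * effective_rank ?V * exp (- (r * t / 2)))" by (simp only: mult_ac)
    finally have "?P \<le> 14 * effective_rank ?V * exp (- (r * t / 2))"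
      using c(2) by (simp only: mult_le_cancel_left_pos)
    thus ?thesis unfolding r(5) .
  qed
qed

end
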